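(* The extreme rays of $\mathcal N(F)$ are precisely the rays spanned by the following quadratic polynomials, and $\mathcal N(F)$ is the conic hull of these extreme rays: (1) (interior affine-square rays) $\ell(\mathbf x)^2$, where $\ell$ is a nonconstant affine function on $\mathbb R^2$ whose zero set meets $\operatorname{int}(F)$; (2) (axis-square rays) $x_1^2$ and $x_2^2$; (3) (coordinate rays) $x_1$, $x_2$, and $x_1x_2$; (4) (hyperbola ray) $1-x_1x_2$; (5) (lifted tangent rays) $h_w(\mathbf x):=x_1+w^2x_2-2wx_1x_2$, for $w>0$; (6) (bitangent rays) for $0\le u<v$, $$g^1_{u,v}(\mathbf x):=(x_1-u)^2+(v-u)x_2\bigl(2v^2-(3v-u)x_1\bigr),$$ $$g^2_{u,v}(\mathbf x):=(x_2-u)^2+(v-u)x_1\bigl(2v^2-(3v-u)x_2\bigr).$$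
   Context: Let $F:=\{\mathbf x=(x_1,x_2)\in\mathbb R^2 : x_1\ge 0,\ x_2\ge 0,\ x_1x_2\le 1\}$. For a symmetric matrix $R\in\mathbb R^{2\times 2}$, $\mathbf r\in\mathbb R^2$, $p\in\mathbb R$, let $q_{R,\mathbf r,p}(\mathbf x):=\mathbf x^\top R\mathbf x+2\mathbf r^\top\mathbf x+p$. $\mathcal N(F)$ is the convex cone of all polynomials $q_{R,\mathbf r,p}$ (i.e. all real polynomials in $x_1,x_2$ of degree at most $2$) that are nonnegative on $F$; it is regarded as a cone in the $6$-dimensional space of coefficients $(R,\mathbf r,p)$. A nonzero $q\in\mathcal N(F)$ spans an extreme ray of $\mathcal N(F)$ if whenever $q=q_1+q_2$ with $q_1,q_2\in\mathcal N(F)$, both $q_1$ and $q_2$ are nonnegative multiples of $q$. The conic hull of a set is the set of all finite nonnegative linear combinations of its elements. *)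

theory Defs
  imports "HOL-Analysis.Analysis"
begin

definition Freg :: "(real^2) set" where
  "Freg = {x. 0 \<le> x$1 \<and> 0 \<le> x$2 \<and> x$1 * x$2 \<le> 1}"

text \<open>
  A polynomial of degree at most 2 in two variables is given by its coefficients
  \<open>(R, r, p)\<close> with \<open>R\<close> symmetric; symmetry makes the triple unique, and addition and
  scaling of polynomials are the vector space operations on triples.
\<close>

type_synonym quad = "(real^2^2) \<times> (real^2) \<times> real"

definition quads :: "quad set" where
  "quads = {(R, r, p). transpose R = R}"

definition qval :: "quad \<Rightarrow> real^2 \<Rightarrow> real" where
  "qval = (\<lambda>(R, r, p) x. x \<bullet> (R *v x) + 2 * (r \<bullet> x) + p)"

definition nonneg_quads :: "(real^2) set \<Rightarrow> quad set" where
  "nonneg_quads S = {q \<in> quads. \<forall>x\<in>S. 0 \<le> qval q x}"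

definition ray :: "'a::real_vector \<Rightarrow> 'a set" where
  "ray q = {c *\<^sub>R q | c. 0 \<le> c}"

definition spans_extreme_ray :: "'a::real_vector set \<Rightarrow> 'a \<Rightarrow> bool" where
  "spans_extreme_ray K q \<longleftrightarrow> q \<in> K \<and> q \<noteq> 0 \<and>
     (\<forall>q1\<in>K. \<forall>q2\<in>K. q = q1 + q2 \<longrightarrow> q1 \<in> ray q \<and> q2 \<in> ray q)"

definition extreme_rays :: "'a::real_vector set \<Rightarrow> 'a set set" where
  "extreme_rays K = {ray q | q. spans_extreme_ray K q}"

text \<open>
  All finite nonnegative linear combinations. (The library's \<open>conic hull\<close> is something
  else: it only closes a set under nonnegative scaling.)
\<close>

definition conical_combinations :: "'a::real_vector set \<Rightarrow> 'a set" where
  "conical_combinations S =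
     {(\<Sum>s\<in>T. c s *\<^sub>R s) | T c. finite T \<and> T \<subseteq> S \<and> (\<forall>s\<in>T. 0 \<le> c s)}"

definition interior_affine_squares :: "(real^2 \<Rightarrow> real) set" where
  "interior_affine_squares =
     {(\<lambda>x. (a \<bullet> x + b)\<^sup>2) | a b. a \<noteq> 0 \<and> (\<exists>z \<in> interior Freg. a \<bullet> z + b = 0)}"

definition lifted_tangent :: "real \<Rightarrow> real^2 \<Rightarrow> real" where
  "lifted_tangent w x = x$1 + w\<^sup>2 * x$2 - 2 * w * x$1 * x$2"

definition bitangent1 :: "real \<Rightarrow> real \<Rightarrow> real^2 \<Rightarrow> real" where
  "bitangent1 u v x = (x$1 - u)\<^sup>2 + (v - u) * x$2 * (2 * v\<^sup>2 - (3 * v - u) * x$1)"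

definition bitangent2 :: "real \<Rightarrow> real \<Rightarrow> real^2 \<Rightarrow> real" where
  "bitangent2 u v x = (x$2 - u)\<^sup>2 + (v - u) * x$1 * (2 * v\<^sup>2 - (3 * v - u) * x$2)"

text \<open>
  Given as functions; each is \<open>qval q\<close> for exactly one \<open>q \<in> quads\<close>.
\<close>

definition listed_polys :: "(real^2 \<Rightarrow> real) set" where
  "listed_polys =
     interior_affine_squares
     \<union> {\<lambda>x. (x$1)\<^sup>2, \<lambda>x. (x$2)\<^sup>2}
     \<union> {\<lambda>x. x$1, \<lambda>x. x$2, \<lambda>x. x$1 * x$2}
     \<union> {\<lambda>x. 1 - x$1 * x$2}
     \<union> {lifted_tangent w | w. 0 < w}
     \<union> {bitangent1 u v | u v. 0 \<le> u \<and> u < v}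
     \<union> {bitangent2 u v | u v. 0 \<le> u \<and> u < v}"

end

theory Submission
  imports Defs
begin

text \<open>
  A nonnegative quadratic on the region is decomposed into the listed ones by subtracting as much
  as possible of one of them. If the \<open>y\<^sup>2\<close> coefficient vanishes (or, symmetrically, that of
  \<open>x\<^sup>2\<close>), subtracting a multiple of \<open>y\<close> or \<open>x y\<close> either produces a zero on the hyperbola
  \<open>x y = 1\<close> or leaves something visibly decomposable. If both are positive, the polynomial is
  coercive, and after subtracting \<open>t x y\<close> for the largest admissible \<open>t\<close> it has a zero in the
  region near which no further multiple of \<open>x y\<close> fits: at an interior zero, and as it turns out
  at such a zero on an axis, it is a positive semidefinite form or has nonnegative coefficients.

  A zero on the hyperbola may be scaled to \<open>(1, 1)\<close>; with \<open>h = (x - 1, y - 1)\<close> the polynomial is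
  \<open>l (1 - x y) + A h\<^sub>1\<^sup>2 + B h\<^sub>1 h\<^sub>2 + C h\<^sub>2\<^sup>2\<close> with \<open>l \<ge> 0\<close>. Unless the form is semidefinite, \<open>B < 0\<close>,
  and since the bitangent rays with \<open>v = 1\<close>, \<open>s = 1 - u\<close> are \<open>s\<^sup>2 (1 - x y) + h\<^sub>1\<^sup>2 - 2 s h\<^sub>1 h\<^sub>2\<close> and
  the lifted tangent ray is \<open>(1 - x y) - h\<^sub>1 h\<^sub>2\<close>, nonnegativity on the axes gives a decomposition.

  Conversely, a listed polynomial is extreme because a nonnegative summand inherits its zeros,
  with their vanishing first order terms, and its growth along the axes; this fixes the summand
  up to a factor.
\<close>

section \<open>Generators and affine squares\<close>

text \<open>The mixed and linear coefficients are taken whole; the factors 2 of the matrix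
  convention in \<open>qval\<close> reappear only in \<open>quad_of\<close>.\<close>

definition qf :: "real \<Rightarrow> real \<Rightarrow> real \<Rightarrow> real \<Rightarrow> real \<Rightarrow> real \<Rightarrow> real \<Rightarrow> real \<Rightarrow> real" where
  "qf a b c d e p x y = a * x\<^sup>2 + b * x * y + c * y\<^sup>2 + d * x + e * y + p"

definition nonneg_on_F :: "(real \<Rightarrow> real \<Rightarrow> real) \<Rightarrow> bool" where
  "nonneg_on_F f \<longleftrightarrow> (\<forall>x y. 0 \<le> x \<longrightarrow> 0 \<le> y \<longrightarrow> x * y \<le> 1 \<longrightarrow> 0 \<le> f x y)"

text \<open>The list in coordinates, with the interior of the region spelled out by strict
  inequalities; \<open>interior_Freg\<close> and \<open>listed_polys_eq\<close> link it to
  \<open>listed_polys\<close>.\<close>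

inductive generator :: "(real \<Rightarrow> real \<Rightarrow> real) \<Rightarrow> bool" where
  affine_square: "0 < z1 \<Longrightarrow> 0 < z2 \<Longrightarrow> z1 * z2 < 1 \<Longrightarrow> \<alpha> \<noteq> 0 \<or> \<beta> \<noteq> 0 \<Longrightarrow> \<alpha> * z1 + \<beta> * z2 + \<gamma> = 0
    \<Longrightarrow> generator (\<lambda>x y. (\<alpha> * x + \<beta> * y + \<gamma>)\<^sup>2)"
| square_fst: "generator (\<lambda>x y. x\<^sup>2)"
| square_snd: "generator (\<lambda>x y. y\<^sup>2)"
| coord_fst: "generator (\<lambda>x y. x)"
| coord_snd: "generator (\<lambda>x y. y)"
| coord_prod: "generator (\<lambda>x y. x * y)"
| hyperbola: "generator (\<lambda>x y. 1 - x * y)"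
| lifted: "0 < w \<Longrightarrow> generator (\<lambda>x y. x + w\<^sup>2 * y - 2 * w * x * y)"
| bitangent_fst: "0 \<le> u \<Longrightarrow> u < v \<Longrightarrow>
    generator (\<lambda>x y. (x - u)\<^sup>2 + (v - u) * y * (2 * v\<^sup>2 - (3 * v - u) * x))"
| bitangent_snd: "0 \<le> u \<Longrightarrow> u < v \<Longrightarrow>
    generator (\<lambda>x y. (y - u)\<^sup>2 + (v - u) * x * (2 * v\<^sup>2 - (3 * v - u) * y))"

text \<open>The generated cone as an inductive predicate, so that decompositions are assembled by
  introduction rules; \<open>decomp_in_cone\<close> carries them over to coefficient
  triples.\<close>

inductive decomp :: "(real \<Rightarrow> real \<Rightarrow> real) \<Rightarrow> bool" where
  gen: "generator f \<Longrightarrow> decomp f"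
| add: "decomp f \<Longrightarrow> decomp g \<Longrightarrow> decomp (\<lambda>x y. f x y + g x y)"
| scale: "0 \<le> k \<Longrightarrow> decomp f \<Longrightarrow> decomp (\<lambda>x y. k * f x y)"

lemma decomp_cong: "decomp f \<Longrightarrow> (\<And>x y. g x y = f x y) \<Longrightarrow> decomp g"
  by (metis ext)

text \<open>The list is symmetric in the coordinates up to positive factors: the swapped lifted
  tangent with parameter \<open>w\<close> is \<open>w\<^sup>2\<close> times the one with parameter
  \<open>1 / w\<close>.\<close>

lemma decomp_swap:
  assumes "decomp f" shows "decomp (\<lambda>x y. f y x)"
  using assms
proof induction
  case (gen f)
  then show ?case
  proof cases
    case (affine_square z1 z2 \<alpha> \<beta> \<gamma>)
    then have "generator (\<lambda>x y. (\<beta> * x + \<alpha> * y + \<gamma>)\<^sup>2)"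
      by (intro generator.affine_square[of z2 z1]) (auto simp: mult.commute)
    then show ?thesis
      by (rule decomp.gen[THEN decomp_cong]) (simp add: affine_square algebra_simps)
  next
    case coord_prod
    show ?thesis by (rule decomp_cong[OF decomp.gen[OF generator.coord_prod]]) (simp add: coord_prod)
  next
    case hyperbola
    show ?thesis by (rule decomp_cong[OF decomp.gen[OF generator.hyperbola]]) (simp add: hyperbola)
  next
    case (lifted w)
    then have "generator (\<lambda>x y. x + (1 / w)\<^sup>2 * y - 2 * (1 / w) * x * y)"
      by (intro generator.lifted) auto
    then have "decomp (\<lambda>x y. w\<^sup>2 * (x + (1 / w)\<^sup>2 * y - 2 * (1 / w) * x * y))"
      by (intro decomp.scale decomp.gen) auto
    then show ?thesis
      using lifted by (elim decomp_cong) (simp add: field_simps power2_eq_square)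
  qed (auto intro: decomp.gen generator.intros)
qed (auto intro: decomp.intros)

text \<open>A genuine constant \<open>p\<close> arises as \<open>p * (1 - x * y)\<close> together
  with \<open>p\<close> added to the coefficient of \<open>x * y\<close>.\<close>

lemma decomp_nonneg_coeffs:
  assumes "0 \<le> a" "0 \<le> b" "0 \<le> c" "0 \<le> d" "0 \<le> e" "0 \<le> p"
  shows "decomp (\<lambda>x y. a * x\<^sup>2 + b * (x * y) + c * y\<^sup>2 + d * x + e * y + p * (1 - x * y))"
  by (intro decomp.add decomp.scale assms decomp.gen generator.intros)

lemma nonneg_on_FD: "nonneg_on_F f \<Longrightarrow> 0 \<le> x \<Longrightarrow> 0 \<le> y \<Longrightarrow> x * y \<le> 1 \<Longrightarrow> 0 \<le> f x y"
  by (simp add: nonneg_on_F_def)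

lemma generator_nonneg:
  assumes "generator f" shows "nonneg_on_F f"
  using assms
proof cases
  case (lifted w)
  show ?thesis unfolding nonneg_on_F_def lifted
  proof (intro allI impI)
    fix x y :: real assume xy: "0 \<le> x" "0 \<le> y" "x * y \<le> 1"
    \<comment> \<open>AM-GM gives \<open>2 * w * r \<le> x + w\<^sup>2 * y\<close>, and
      \<open>r\<^sup>2 \<le> r\<close> because \<open>r \<le> 1\<close>.\<close>
    define r where "r = sqrt (x * y)"
    have r: "0 \<le> r" "r\<^sup>2 = x * y" "r \<le> 1" using xy by (auto simp: r_def)
    have "r\<^sup>2 \<le> r" unfolding power2_eq_square using r by (intro mult_left_le) auto
    moreover have "0 \<le> (sqrt x - w * sqrt y)\<^sup>2" by simp
    then have "2 * w * r \<le> x + w\<^sup>2 * y"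
      using xy by (simp add: power2_diff r_def real_sqrt_mult algebra_simps)
    ultimately show "0 \<le> x + w\<^sup>2 * y - 2 * w * x * y"
      using lifted r by (smt (verit) mult_left_mono mult.assoc)
  qed
next
  have bit: "0 \<le> (x - u)\<^sup>2 + (v - u) * y * (2 * v\<^sup>2 - (3 * v - u) * x)"
    if uv: "0 \<le> u" "u < v" and xy: "0 \<le> x" "0 \<le> y" "x * y \<le> 1" for u v x y :: real
  proof -
    \<comment> \<open>For fixed \<open>x\<close> the polynomial is affine in \<open>y\<close>, hence
      interpolates its values at \<open>y = 0\<close> and \<open>y = 1 / x\<close>; \<open>x\<close>
      times the latter is a cubic with double root \<open>v\<close>.\<close>
    have "(x - u)\<^sup>2 + (v - u) * y * (2 * v\<^sup>2 - (3 * v - u) * x)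
        = (1 - x * y) * (x - u)\<^sup>2 + y * ((x - v)\<^sup>2 * (x + 2 * (v - u)))"
      by (simp add: algebra_simps power2_eq_square power3_eq_cube)
    then show ?thesis using uv xy by simp
  qed
  {
    case (bitangent_fst u v)
    then show ?thesis using bit by (simp add: nonneg_on_F_def)
  next
    case (bitangent_snd u v)
    then show ?thesis using bit by (simp add: nonneg_on_F_def mult.commute)
  }
qed (auto simp: nonneg_on_F_def)

text \<open>The region \<open>x, y > 0\<close>, \<open>x y < 1\<close> is connected because it is convex in logarithmic coordinates.\<close>

lemma affine_zero_between:
  fixes p1 p2 q1 q2 \<alpha> \<beta> \<gamma> :: real
  assumes p: "0 < p1" "0 < p2" "p1 * p2 < 1" and q: "0 < q1" "0 < q2" "q1 * q2 < 1"
    and sgn: "\<alpha> * p1 + \<beta> * p2 + \<gamma> \<le> 0" "0 \<le> \<alpha> * q1 + \<beta> * q2 + \<gamma>"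
  shows "\<exists>z1 z2. 0 < z1 \<and> 0 < z2 \<and> z1 * z2 < 1 \<and> \<alpha> * z1 + \<beta> * z2 + \<gamma> = 0"
proof -
  define z where "z r s t = exp ((1 - t) * ln r + t * ln s)" for r s t :: real
  have "\<exists>t\<ge>0. t \<le> 1 \<and> \<alpha> * z p1 q1 t + \<beta> * z p2 q2 t + \<gamma> = 0"
  proof (rule IVT')
    show "continuous_on {0..1} (\<lambda>t. \<alpha> * z p1 q1 t + \<beta> * z p2 q2 t + \<gamma>)"
      unfolding z_def by (intro continuous_intros)
  qed (use p q sgn in \<open>auto simp: z_def\<close>)
  then obtain t where t: "0 \<le> t" "t \<le> 1" "\<alpha> * z p1 q1 t + \<beta> * z p2 q2 t + \<gamma> = 0" by auto
  have "ln (p1 * p2) < 0" "ln (q1 * q2) < 0" using p q by (simp_all add: ln_less_zero)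
  then have "(1 - t) * ln (p1 * p2) + t * ln (q1 * q2) < 0"
    using t by (smt (verit) mult_nonneg_nonpos mult_pos_neg)
  also have "(1 - t) * ln (p1 * p2) + t * ln (q1 * q2)
      = ((1 - t) * ln p1 + t * ln q1) + ((1 - t) * ln p2 + t * ln q2)"
    using p q by (simp add: ln_mult algebra_simps)
  finally have "z p1 q1 t * z p2 q2 t < 1"
    unfolding z_def exp_add[symmetric] by simp
  moreover have "0 < z p1 q1 t" "0 < z p2 q2 t" by (auto simp: z_def)
  ultimately show ?thesis using t by blast
qed

text \<open>Far out along an axis the slope in that direction decides the sign; near the origin the
  constant does.\<close>

lemma affine_coeffs_nonneg:
  fixes \<alpha> \<beta> \<gamma> :: real
  assumes pos: "\<And>x y. 0 < x \<Longrightarrow> 0 < y \<Longrightarrow> x * y < 1 \<Longrightarrow> 0 \<le> \<alpha> * x + \<beta> * y + \<gamma>"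
  shows "0 \<le> \<alpha>" "0 \<le> \<beta>" "0 \<le> \<gamma>"
proof -
  have far: "0 \<le> m" if *: "\<And>x y. 0 < x \<Longrightarrow> 0 < y \<Longrightarrow> x * y < 1 \<Longrightarrow> 0 \<le> m * x + n * y + \<gamma>" for m n
  proof (rule ccontr)
    assume m: "\<not> 0 \<le> m"
    \<comment> \<open>At \<open>(x, 1 / (2 * x))\<close> the term \<open>m * x\<close> equals
      \<open>m - |n| - |\<gamma>|\<close> and outweighs the other two.\<close>
    define x where "x = 1 + (\<bar>n\<bar> + \<bar>\<gamma>\<bar>) / \<bar>m\<bar>"
    have x: "1 \<le> x" by (simp add: x_def)
    have "m * x = m - \<bar>n\<bar> - \<bar>\<gamma>\<bar>" using m by (simp add: x_def field_simps)
    moreover have "n * (1 / (2 * x)) \<le> \<bar>n\<bar> * 1"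
      using x by (intro mult_mono) auto
    moreover have "0 \<le> m * x + n * (1 / (2 * x)) + \<gamma>" using x by (intro *) auto
    ultimately show False using m by linarith
  qed
  show "0 \<le> \<alpha>" by (rule far) (rule pos)
  have "0 \<le> \<beta> * x + \<alpha> * y + \<gamma>" if "0 < x" "0 < y" "x * y < 1" for x y
    using pos[of y x] that by (simp add: algebra_simps)
  then show "0 \<le> \<beta>" by (rule far)
  show "0 \<le> \<gamma>"
  proof (rule ccontr)
    assume g: "\<not> 0 \<le> \<gamma>"
    \<comment> \<open>Small enough that \<open>(t, t)\<close> lies in the region and the two linear
      terms stay below \<open>- \<gamma> / 2\<close>.\<close>
    define t where "t = min (1/2) (- \<gamma> / (2 * (1 + \<bar>\<alpha>\<bar> + \<bar>\<beta>\<bar>)))"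
    have "0 < t" using g by (auto simp: t_def divide_simps)
    moreover have "t \<le> 1/2" unfolding t_def by (rule min.cobounded1)
    ultimately have t: "0 < t" "t \<le> 1/2" by auto
    have "t \<le> - \<gamma> / (2 * (1 + \<bar>\<alpha>\<bar> + \<bar>\<beta>\<bar>))" unfolding t_def by (rule min.cobounded2)
    then have "t + \<bar>\<alpha>\<bar> * t + \<bar>\<beta>\<bar> * t \<le> - \<gamma> / 2"
      by (simp add: field_simps)
    moreover have "t * t < 1" using t mult_mono[of t "1/2" t "1/2"] by simp
    then have "0 \<le> \<alpha> * t + \<beta> * t + \<gamma>" using t pos by blast
    moreover have "\<alpha> * t \<le> \<bar>\<alpha>\<bar> * t" "\<beta> * t \<le> \<bar>\<beta>\<bar> * t" using t by (auto intro!: mult_right_mono)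
    ultimately show False using g t by linarith
  qed
qed

text \<open>Without an interior zero the affine function has constant sign inside the region, so up
  to sign its coefficients are nonnegative, and the square expands into coordinate terms and
  \<open>1 - x * y\<close>.\<close>

lemma decomp_affine_square: "decomp (\<lambda>x y. (\<alpha> * x + \<beta> * y + \<gamma>)\<^sup>2)"
proof (cases "\<exists>z1 z2. 0 < z1 \<and> 0 < z2 \<and> z1 * z2 < 1 \<and> \<alpha> * z1 + \<beta> * z2 + \<gamma> = 0 \<and> (\<alpha> \<noteq> 0 \<or> \<beta> \<noteq> 0)")
  case True
  then show ?thesis by (auto intro: decomp.gen generator.affine_square)
next
  case no_zero: False
  have nonneg: "decomp (\<lambda>x y. (a * x + b * y + c)\<^sup>2)"
    if *: "0 \<le> a" "0 \<le> b" "0 \<le> c" for a b c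
  proof -
    have "decomp (\<lambda>x y. a\<^sup>2 * x\<^sup>2 + (2 * a * b + c\<^sup>2) * (x * y) + b\<^sup>2 * y\<^sup>2 + (2 * a * c) * x
        + (2 * b * c) * y + c\<^sup>2 * (1 - x * y))"
      using * by (intro decomp_nonneg_coeffs) auto
    then show ?thesis by (rule decomp_cong) (simp add: power2_eq_square algebra_simps)
  qed
  show ?thesis
  proof (cases "\<forall>x y. 0 < x \<longrightarrow> 0 < y \<longrightarrow> x * y < 1 \<longrightarrow> 0 \<le> \<alpha> * x + \<beta> * y + \<gamma>")
    case True
    then show ?thesis using affine_coeffs_nonneg[of \<alpha> \<beta> \<gamma>] nonneg by blast
  next
    case False
    then obtain p1 p2 where p: "0 < p1" "0 < p2" "p1 * p2 < 1" "\<alpha> * p1 + \<beta> * p2 + \<gamma> < 0" by force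
    show ?thesis
    proof (cases "\<alpha> \<noteq> 0 \<or> \<beta> \<noteq> 0")
      case True
      have "0 \<le> (-\<alpha>) * x + (-\<beta>) * y + (-\<gamma>)" if "0 < x" "0 < y" "x * y < 1" for x y
        using affine_zero_between[OF p(1-3) that, of \<alpha> \<beta> \<gamma>] no_zero True p(4) by force
      then have "decomp (\<lambda>x y. ((-\<alpha>) * x + (-\<beta>) * y + (-\<gamma>))\<^sup>2)"
        using affine_coeffs_nonneg[of "-\<alpha>" "-\<beta>" "-\<gamma>"] nonneg by blast
      then show ?thesis by (rule decomp_cong) (simp add: power2_eq_square algebra_simps)
    next
      case False
      have "decomp (\<lambda>x y. (0 * x + 0 * y + \<bar>\<gamma>\<bar>)\<^sup>2)" by (intro nonneg) auto
      then show ?thesis using False by (elim decomp_cong) simp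
    qed
  qed
qed

text \<open>Completing the square leaves two squares of affine functions. The factors
  \<open>k\<close> and \<open>l\<close> admit the rescaled coordinates \<open>x / v\<close> and
  \<open>v * y\<close>.\<close>

lemma decomp_psd_form:
  fixes a b c :: real
  assumes "0 \<le> a" "0 \<le> c" "b\<^sup>2 \<le> 4 * a * c"
  shows "decomp (\<lambda>x y. a * (k * x - m)\<^sup>2 + b * (k * x - m) * (l * y - n) + c * (l * y - n)\<^sup>2)"
proof (cases "a = 0")
  case True
  have "decomp (\<lambda>x y. c * (0 * x + l * y + (- n))\<^sup>2)"
    using assms by (intro decomp.scale decomp_affine_square)
  then show ?thesis using True assms by (elim decomp_cong) simp
next
  case False
  have "decomp (\<lambda>x y. a * (k * x + (b / (2 * a) * l) * y + (- m - b / (2 * a) * n))\<^sup>2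
      + (c - b\<^sup>2 / (4 * a)) * (0 * x + l * y + (- n))\<^sup>2)"
    using assms False
    by (intro decomp.add decomp.scale decomp_affine_square) (auto simp: field_simps)
  then show ?thesis
    using False by (elim decomp_cong) (simp add: field_simps power2_eq_square)
qed

section \<open>Zeros in the interior and on the hyperbola\<close>

text \<open>Yields first order conditions: an inequality is divided by a small \<open>t > 0\<close>,
  and then \<open>t\<close> tends to 0.\<close>

lemma nonneg_limit:
  fixes f :: "real \<Rightarrow> real"
  assumes "isCont f 0" "0 < \<delta>" "\<And>t. 0 < t \<Longrightarrow> t < \<delta> \<Longrightarrow> 0 \<le> f t"
  shows "0 \<le> f 0"
proof (rule tendsto_lowerbound)
  show "(f \<longlongrightarrow> f 0) (at_right 0)"
    using assms(1) by (simp add: isCont_def filterlim_at_split)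
  show "\<forall>\<^sub>F t in at_right 0. 0 \<le> f t"
    using assms(2,3) by (auto simp: eventually_at_right)
qed simp

lemma qf_swap: "qf a b c d e p y x = qf c b a e d p x y"
  by (simp add: qf_def)

lemma nonneg_on_F_swap: "nonneg_on_F (qf a b c d e p) \<Longrightarrow> nonneg_on_F (qf c b a e d p)"
  unfolding nonneg_on_F_def by (metis qf_swap mult.commute)

lemma decomp_qf_swap: "decomp (qf a b c d e p) \<Longrightarrow> decomp (qf c b a e d p)"
  by (erule decomp_cong[OF decomp_swap]) (rule qf_swap[symmetric])

lemma nonneg_on_F_axis:
  assumes "nonneg_on_F (qf a b c d e p)" "0 \<le> x"
  shows "0 \<le> a * x\<^sup>2 + d * x + p"
  using nonneg_on_FD[OF assms(1), of x 0] assms(2) by (simp add: qf_def)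

text \<open>The restrictions to the axes suffice. Putting \<open>x = 1 / t\<close> and multiplying
  by \<open>t\<^sup>2\<close> turns leading coefficients into limits at
  \<open>t = 0\<close>.\<close>

lemma nonneg_on_F_coeffs:
  assumes nn: "nonneg_on_F (qf a b c d e p)"
  shows "0 \<le> a" "0 \<le> c" "0 \<le> p" "a = 0 \<Longrightarrow> 0 \<le> d" "c = 0 \<Longrightarrow> 0 \<le> e"
proof -
  have *: "0 \<le> a \<and> (a = 0 \<longrightarrow> 0 \<le> d)" if nn: "nonneg_on_F (qf a b c d e p)" for a b c d e p
  proof -
    have pos: "0 \<le> a + d * t + p * t\<^sup>2" if "0 < t" for t
    proof -
      have "0 \<le> t\<^sup>2 * (a * (1 / t)\<^sup>2 + d * (1 / t) + p)"
        using nonneg_on_F_axis[OF nn, of "1 / t"] that by simp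
      also have "\<dots> = a + d * t + p * t\<^sup>2" using that by (simp add: field_simps power2_eq_square)
      finally show ?thesis .
    qed
    have "0 \<le> a + d * 0 + p * 0\<^sup>2"
      by (rule nonneg_limit[of "\<lambda>t. a + d * t + p * t\<^sup>2" 1]) (auto intro: pos)
    moreover have "0 \<le> d + p * 0" if "a = 0"
    proof (rule nonneg_limit[of "\<lambda>t. d + p * t" 1])
      fix t :: real assume t: "0 < t"
      then have "0 \<le> t * (d + p * t)"
        using pos[of t] that by (simp add: algebra_simps power2_eq_square)
      with t show "0 \<le> d + p * t" by (simp add: zero_le_mult_iff)
    qed auto
    ultimately show ?thesis by simp
  qed
  show "0 \<le> a" "a = 0 \<Longrightarrow> 0 \<le> d" "0 \<le> c" "c = 0 \<Longrightarrow> 0 \<le> e"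
    using *[OF nn] *[OF nonneg_on_F_swap[OF nn]] by auto
  show "0 \<le> p" using nonneg_on_F_axis[OF nn, of 0] by simp
qed

lemma psd_discriminant:
  fixes a b c :: real
  assumes "\<And>m n. 0 \<le> a * m\<^sup>2 + b * m * n + c * n\<^sup>2"
  shows "0 \<le> a" "0 \<le> c" "b\<^sup>2 \<le> 4 * a * c"
proof -
  show a: "0 \<le> a" using assms[of 1 0] by simp
  show c: "0 \<le> c" using assms[of 0 1] by simp
  show "b\<^sup>2 \<le> 4 * a * c"
  proof (cases "a = 0")
    case True
    have "b = 0"
    proof (rule ccontr)
      assume "b \<noteq> 0"
      \<comment> \<open>For \<open>a = 0\<close> the form takes the value -1 at this point.\<close>
      then show False using assms[of "- (c + 1) / b" 1] True by simp
    qed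
    then show ?thesis using a c by simp
  next
    case False
    \<comment> \<open>For \<open>n = 2 * a\<close>, the choice \<open>m = - b\<close> minimises the
      form in \<open>m\<close>.\<close>
    have "0 \<le> a * (4 * a * c - b\<^sup>2)"
      using assms[of "- b" "2 * a"] by (simp add: algebra_simps power2_eq_square)
    then show ?thesis using a False by (simp add: zero_le_mult_iff)
  qed
qed

text \<open>An interior zero is a minimum: the gradient vanishes and the second order part is
  semidefinite. The Taylor expansion of a quadratic is exact, so nothing else remains.\<close>

lemma interior_zero:
  assumes nn: "nonneg_on_F (qf a b c d e p)" and z: "0 < z1" "0 < z2" "z1 * z2 < 1"
    and zero: "qf a b c d e p z1 z2 = 0"
  shows "0 \<le> a" "0 \<le> c" "b\<^sup>2 \<le> 4 * a * c"
    "qf a b c d e p x y = a * (x - z1)\<^sup>2 + b * (x - z1) * (y - z2) + c * (y - z2)\<^sup>2"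
proof -
  define G1 where "G1 = 2 * a * z1 + b * z2 + d"
  define G2 where "G2 = 2 * c * z2 + b * z1 + e"
  have taylor: "qf a b c d e p (z1 + m) (z2 + n) = G1 * m + G2 * n + a * m\<^sup>2 + b * m * n + c * n\<^sup>2" for m n
    using zero unfolding qf_def G1_def G2_def by (simp add: algebra_simps power2_eq_square)
  have near: "\<exists>\<delta>>0. \<forall>t. 0 < t \<longrightarrow> t < \<delta> \<longrightarrow> 0 \<le> (G1 * m + G2 * n) + t * (a * m\<^sup>2 + b * m * n + c * n\<^sup>2)" for m n
  proof -
    have "\<forall>\<^sub>F t in at_right 0. 0 < z1 + t * m \<and> 0 < z2 + t * n \<and> (z1 + t * m) * (z2 + t * n) < 1"
    proof (intro eventually_conj order_tendstoD)
      show "((\<lambda>t. z1 + t * m) \<longlongrightarrow> z1 + 0 * m) (at_right 0)" "((\<lambda>t. z2 + t * n) \<longlongrightarrow> z2 + 0 * n) (at_right 0)"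
        "((\<lambda>t. (z1 + t * m) * (z2 + t * n)) \<longlongrightarrow> (z1 + 0 * m) * (z2 + 0 * n)) (at_right 0)"
        by (intro tendsto_intros)+
    qed (use z in auto)
    then obtain \<delta> where \<delta>: "\<delta> > 0"
      "\<And>t. 0 < t \<Longrightarrow> t < \<delta> \<Longrightarrow> 0 < z1 + t * m \<and> 0 < z2 + t * n \<and> (z1 + t * m) * (z2 + t * n) < 1"
      unfolding eventually_at_right[OF zero_less_one] by blast
    have "0 \<le> (G1 * m + G2 * n) + t * (a * m\<^sup>2 + b * m * n + c * n\<^sup>2)" if t: "0 < t" "t < \<delta>" for t
    proof -
      have "0 \<le> qf a b c d e p (z1 + t * m) (z2 + t * n)"
        using \<delta>(2)[OF t] by (intro nonneg_on_FD[OF nn]) auto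
      also have "\<dots> = t * ((G1 * m + G2 * n) + t * (a * m\<^sup>2 + b * m * n + c * n\<^sup>2))"
        unfolding taylor by (simp add: algebra_simps power2_eq_square)
      finally show ?thesis using t by (simp add: zero_le_mult_iff)
    qed
    then show ?thesis using \<delta>(1) by blast
  qed
  have grad: "0 \<le> G1 * m + G2 * n" for m n
  proof -
    obtain \<delta> where \<delta>: "\<delta> > 0" "\<And>t. 0 < t \<Longrightarrow> t < \<delta> \<Longrightarrow>
        0 \<le> (G1 * m + G2 * n) + t * (a * m\<^sup>2 + b * m * n + c * n\<^sup>2)"
      using near by blast
    have "0 \<le> (G1 * m + G2 * n) + 0 * (a * m\<^sup>2 + b * m * n + c * n\<^sup>2)"
      by (rule nonneg_limit[OF _ \<delta>]) auto
    then show ?thesis by simp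
  qed
  have G: "G1 = 0" "G2 = 0"
    using grad[of 1 0] grad[of "-1" 0] grad[of 0 1] grad[of 0 "-1"] by auto
  have psd: "0 \<le> a * m\<^sup>2 + b * m * n + c * n\<^sup>2" for m n
  proof -
    obtain \<delta> where \<delta>: "\<delta> > 0" "\<And>t. 0 < t \<Longrightarrow> t < \<delta> \<Longrightarrow>
        0 \<le> (G1 * m + G2 * n) + t * (a * m\<^sup>2 + b * m * n + c * n\<^sup>2)"
      using near by blast
    show ?thesis using \<delta>(2)[of "\<delta> / 2"] \<delta>(1) G by (simp add: zero_le_mult_iff)
  qed
  show "0 \<le> a" "0 \<le> c" "b\<^sup>2 \<le> 4 * a * c" using psd_discriminant[OF psd] by auto
  show "qf a b c d e p x y = a * (x - z1)\<^sup>2 + b * (x - z1) * (y - z2) + c * (y - z2)\<^sup>2"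
    using taylor[of "x - z1" "y - z2"] G by simp
qed

text \<open>The hypothesis \<open>axis\<close> is nonnegativity at \<open>(v * (1 - s), 0)\<close>,
  where the two factors are \<open>- s\<close> and \<open>-1\<close>. The \<open>s\<close> in
  \<open>[0, 1]\<close> that minimises its right-hand side, either \<open>\<beta> / (2 * A)\<close>
  or 1, selects the bitangent ray to split off.\<close>

lemma decomp_hyperbola_form:
  fixes v A \<beta> C l :: real
  assumes v: "0 < v" and AC: "0 \<le> C" "C \<le> A" and \<beta>: "0 < \<beta>" "4 * A * C < \<beta>\<^sup>2"
    and axis: "\<And>s. 0 \<le> s \<Longrightarrow> s \<le> 1 \<Longrightarrow> 0 \<le> l + A * s\<^sup>2 - \<beta> * s + C"
  shows "decomp (\<lambda>x y. l * (1 - x * y) + A * (x / v - 1)\<^sup>2 - \<beta> * (x / v - 1) * (v * y - 1) + C * (v * y - 1)\<^sup>2)"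
proof -
  have bit: "decomp (\<lambda>x y. s\<^sup>2 * (1 - x * y) + (x / v - 1)\<^sup>2 - 2 * s * (x / v - 1) * (v * y - 1))"
    if s: "0 < s" "s \<le> 1" for s
  proof -
    \<comment> \<open>In the coordinates centred at \<open>(v, 1 / v)\<close> the parameter is
      \<open>s = (v - u) / v\<close>; the value \<open>s = 1\<close> is
      \<open>u = 0\<close>.\<close>
    let ?u = "v * (1 - s)"
    have "generator (\<lambda>x y. (x - ?u)\<^sup>2 + (v - ?u) * y * (2 * v\<^sup>2 - (3 * v - ?u) * x))"
      using v s by (intro generator.bitangent_fst) auto
    then have "decomp (\<lambda>x y. (1 / v\<^sup>2) * ((x - ?u)\<^sup>2 + (v - ?u) * y * (2 * v\<^sup>2 - (3 * v - ?u) * x)))"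
      by (intro decomp.scale decomp.gen) auto
    then show ?thesis
      by (rule decomp_cong) (use v in \<open>simp add: field_simps power2_eq_square\<close>)
  qed
  have lift: "decomp (\<lambda>x y. (1 - x * y) - (x / v - 1) * (v * y - 1))"
  proof -
    have "decomp (\<lambda>x y. (1 / v) * (x + v\<^sup>2 * y - 2 * v * x * y))"
      using v by (intro decomp.scale decomp.gen generator.lifted) auto
    then show ?thesis
      by (rule decomp_cong) (use v in \<open>simp add: field_simps power2_eq_square\<close>)
  qed
  have square: "decomp (\<lambda>x y. ((x / v - 1) - s * (v * y - 1))\<^sup>2)" for s
    by (rule decomp_cong[OF decomp_affine_square[of "1 / v" "- s * v" "s - 1"]]) (simp add: algebra_simps)
  show ?thesis
  proof (cases "\<beta> \<le> 2 * A")
    case True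
    define s where "s = \<beta> / (2 * A)"
    have A: "0 < A" using True \<beta> by simp
    have s: "0 < s" "s \<le> 1" and \<beta>_eq: "\<beta> = 2 * A * s"
      using True \<beta> A by (auto simp: s_def)
    \<comment> \<open>The share of \<open>1 - x * y\<close> consumed by the bitangent term.
      Indefiniteness of the form makes it positive, and \<open>axis\<close> at the minimiser makes
      it at most \<open>l\<close>.\<close>
    define m where "m = A * s\<^sup>2 - C"
    have "A * C < A * (A * s\<^sup>2)" using \<beta>(2) unfolding \<beta>_eq by (simp add: power2_eq_square mult_ac)
    then have m: "0 < m" using A by (simp add: m_def)
    have "m \<le> l" using axis[of s] s by (simp add: \<beta>_eq m_def power2_eq_square algebra_simps)
    then have "decomp (\<lambda>x y. (l - m) * (1 - x * y)
        + m / s\<^sup>2 * (s\<^sup>2 * (1 - x * y) + (x / v - 1)\<^sup>2 - 2 * s * (x / v - 1) * (v * y - 1))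
        + C / s\<^sup>2 * ((x / v - 1) - s * (v * y - 1))\<^sup>2)"
      using m s AC by (intro decomp.add decomp.scale bit square decomp.gen generator.hyperbola) auto
    then show ?thesis
    proof (rule decomp_cong)
      fix x y
      define X where "X = x / v - 1"
      define Y where "Y = v * y - 1"
      show "l * (1 - x * y) + A * (x / v - 1)\<^sup>2 - \<beta> * (x / v - 1) * (v * y - 1) + C * (v * y - 1)\<^sup>2
          = (l - m) * (1 - x * y)
        + m / s\<^sup>2 * (s\<^sup>2 * (1 - x * y) + (x / v - 1)\<^sup>2 - 2 * s * (x / v - 1) * (v * y - 1))
        + C / s\<^sup>2 * ((x / v - 1) - s * (v * y - 1))\<^sup>2"
        unfolding X_def[symmetric] Y_def[symmetric] using s
        by (simp add: \<beta>_eq m_def field_simps power2_eq_square)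
    qed
  next
    case False
    \<comment> \<open>The minimum is at \<open>s = 1\<close>, the origin. The square, the bitangent
      with \<open>u = 0\<close> and the lifted tangent all vanish there, so the weight of
      \<open>1 - x * y\<close> is the value at the origin.\<close>
    have "\<beta> - A - C \<le> l" using axis[of 1] by simp
    then have "decomp (\<lambda>x y. (l - (\<beta> - A - C)) * (1 - x * y) + C * ((x / v - 1) - 1 * (v * y - 1))\<^sup>2
        + (A - C) * (1\<^sup>2 * (1 - x * y) + (x / v - 1)\<^sup>2 - 2 * 1 * (x / v - 1) * (v * y - 1))
        + (\<beta> - 2 * A) * ((1 - x * y) - (x / v - 1) * (v * y - 1)))"
      using False AC by (intro decomp.add decomp.scale bit lift square decomp.gen generator.hyperbola) auto
    then show ?thesis
    proof (rule decomp_cong)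
      fix x y
      define X where "X = x / v - 1"
      define Y where "Y = v * y - 1"
      show "l * (1 - x * y) + A * (x / v - 1)\<^sup>2 - \<beta> * (x / v - 1) * (v * y - 1) + C * (v * y - 1)\<^sup>2
          = (l - (\<beta> - A - C)) * (1 - x * y) + C * ((x / v - 1) - 1 * (v * y - 1))\<^sup>2
        + (A - C) * (1\<^sup>2 * (1 - x * y) + (x / v - 1)\<^sup>2 - 2 * 1 * (x / v - 1) * (v * y - 1))
        + (\<beta> - 2 * A) * ((1 - x * y) - (x / v - 1) * (v * y - 1))"
        unfolding X_def[symmetric] Y_def[symmetric]
        by (simp add: algebra_simps power2_eq_square)
    qed
  qed
qed

text \<open>Stationarity along the hyperbola makes the gradient at \<open>(1, 1)\<close> a multiple
  of that of \<open>1 - x * y\<close>, and moving inwards gives the sign of the multiplier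
  \<open>l\<close>. The remaining form is then tested on the whole hyperbola, not only near
  \<open>(1, 1)\<close>.\<close>

lemma hyperbola_zero_normal_form:
  assumes nn: "nonneg_on_F (qf A b C D E p)" and zero: "qf A b C D E p 1 1 = 0"
  obtains l where "0 \<le> l" "D = - l - 2 * A - b" "E = - l - 2 * C - b" "p = A + C + b + 2 * l"
    "(b + l)\<^sup>2 \<le> 4 * A * C \<or> b + l < 0"
proof -
  have sum0: "A + b + C + D + E + p = 0" using zero by (simp add: qf_def)
  note AC = nonneg_on_F_coeffs(1,2)[OF nn]
  \<comment> \<open>The cofactor of \<open>t\<close> in \<open>(1 + t)\<^sup>2\<close> times the
    polynomial at \<open>(1 + t, 1 / (1 + t))\<close>. Since \<open>t\<close> changes sign,
    \<open>R 0 = 0\<close>.\<close>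
  define R where "R t = (2 * A + D - 2 * C - E) + t * (6 * A + 3 * D + b + p) + t\<^sup>2 * (4 * A + D) + t ^ 3 * A" for t
  have hyp: "0 \<le> t * R t" if "- 1 < t" for t
  proof -
    have "0 \<le> (1 + t)\<^sup>2 * qf A b C D E p (1 + t) (1 / (1 + t))"
      using that by (intro mult_nonneg_nonneg nonneg_on_FD[OF nn]) auto
    also have "\<dots> = A * (1 + t) ^ 4 + (b + p) * (1 + t)\<^sup>2 + C + D * (1 + t) ^ 3 + E * (1 + t)"
    proof -
      define X where "X = 1 + t"
      have "X \<noteq> 0" using that by (simp add: X_def)
      then show ?thesis unfolding X_def[symmetric]
        by (simp add: qf_def field_simps power2_eq_square power3_eq_cube power4_eq_xxxx)
    qed
    also have "\<dots> = t * R t"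
    proof -
      have p: "p = - (A + b + C + D + E)" using sum0 by simp
      show ?thesis
        unfolding R_def p by (simp add: algebra_simps power2_eq_square power3_eq_cube power4_eq_xxxx)
    qed
    finally show ?thesis .
  qed
  have cont: "isCont R 0" "isCont (\<lambda>t. - R (- t)) 0" unfolding R_def by auto
  have "0 \<le> R 0"
    by (rule nonneg_limit[OF cont(1) zero_less_one])
      (use hyp in \<open>simp add: zero_le_mult_iff\<close>, smt (verit) hyp zero_le_mult_iff)
  moreover have "0 \<le> - R (- 0)"
    by (rule nonneg_limit[OF cont(2) zero_less_one])
      (smt (verit) hyp zero_le_mult_iff)
  ultimately have R0: "2 * A + D = 2 * C + E" by (simp add: R_def)
  define l where "l = - (2 * A + b + D)"
  have D: "D = - l - 2 * A - b" by (simp add: l_def)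
  have E: "E = - l - 2 * C - b" using R0 by (simp add: l_def)
  have p: "p = A + C + b + 2 * l" using sum0 D E by simp
  have "0 \<le> 2 * l + 0 * (A + b + C)"
  proof (rule nonneg_limit[of "\<lambda>t. 2 * l + t * (A + b + C)" 1])
    fix t :: real assume t: "0 < t" "t < 1"
    have "0 \<le> qf A b C D E p (1 - t) (1 - t)"
      using t by (intro nonneg_on_FD[OF nn]) (auto simp: mult_le_one)
    also have "\<dots> = t * (2 * l + t * (A + b + C))"
      unfolding D E p by (simp add: qf_def algebra_simps power2_eq_square)
    finally show "0 \<le> 2 * l + t * (A + b + C)" using t by (simp add: zero_le_mult_iff)
  qed auto
  then have l: "0 \<le> l" by simp
  \<comment> \<open>On the hyperbola the factor \<open>(X - 1)\<^sup>2\<close> splits off, as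
    \<open>1 / X - 1 = - (X - 1) / X\<close>; the value at \<open>X = 1\<close> follows by
    continuity.\<close>
  have tan: "0 \<le> A * X\<^sup>2 - (b + l) * X + C" if X: "0 < X" for X
  proof -
    have ne: "0 \<le> A * X\<^sup>2 - (b + l) * X + C" if X: "0 < X" "X \<noteq> 1" for X
    proof -
      have "0 \<le> X\<^sup>2 * qf A b C D E p X (1 / X)"
        using X by (intro mult_nonneg_nonneg nonneg_on_FD[OF nn]) auto
      also have "\<dots> = (X - 1)\<^sup>2 * (A * X\<^sup>2 - (b + l) * X + C)"
        using X unfolding D E p by (simp add: qf_def field_simps power2_eq_square)
      finally show ?thesis using X by (simp add: zero_le_mult_iff)
    qed
    have "0 \<le> A * (X + 0)\<^sup>2 - (b + l) * (X + 0) + C"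
    \<comment> \<open>For \<open>X < 1\<close> the bound \<open>1 - X\<close> on \<open>t\<close>
      keeps \<open>X + t\<close> away from 1.\<close>
    proof (rule nonneg_limit[of "\<lambda>t. A * (X + t)\<^sup>2 - (b + l) * (X + t) + C" "if X < 1 then 1 - X else 1"])
    qed (use X in \<open>auto intro!: ne split: if_splits\<close>)
    then show ?thesis by simp
  qed
  have "(b + l)\<^sup>2 \<le> 4 * A * C" if "b + l > 0"
  proof (cases "A = 0")
    case True
    \<comment> \<open>For \<open>A = 0\<close> the expression would be -1 at this point.\<close>
    show ?thesis using tan[of "(C + 1) / (b + l)"] that True AC by simp
  next
    case False
    then have A: "0 < A" using AC by simp
    have "0 \<le> 4 * A * (A * ((b + l) / (2 * A))\<^sup>2 - (b + l) * ((b + l) / (2 * A)) + C)"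
      using tan[of "(b + l) / (2 * A)"] that A by simp
    also have "\<dots> = 4 * A * C - (b + l)\<^sup>2"
      using A by (simp add: field_simps power2_eq_square)
    finally show ?thesis by simp
  qed
  moreover have "(b + l)\<^sup>2 \<le> 4 * A * C" if "b + l = 0" using AC that by simp
  ultimately have "(b + l)\<^sup>2 \<le> 4 * A * C \<or> b + l < 0" by linarith
  with l D E p that show thesis by blast
qed

text \<open>The scaling \<open>(v * X, Y / v)\<close> preserves the region and moves the zero to
  \<open>(1, 1)\<close>. In the indefinite case \<open>A < C\<close> is reduced to
  \<open>C \<le> A\<close> by swapping coordinates, which replaces \<open>v\<close> by
  \<open>1 / v\<close>.\<close>

lemma decomp_hyperbola_zero:
  assumes nn: "nonneg_on_F (qf a b c d e p)" and v: "0 < v" and zero: "qf a b c d e p v (1 / v) = 0"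
  shows "decomp (qf a b c d e p)"
proof -
  define A where "A = a * v\<^sup>2"
  define C where "C = c / v\<^sup>2"
  have resc: "qf a b c d e p (v * X) (Y / v) = qf A b C (d * v) (e / v) p X Y" for X Y
    using v by (simp add: qf_def A_def C_def field_simps power2_eq_square)
  have nn': "nonneg_on_F (qf A b C (d * v) (e / v) p)"
    unfolding nonneg_on_F_def resc[symmetric] using v by (auto intro: nonneg_on_FD[OF nn])
  have "qf A b C (d * v) (e / v) p 1 1 = 0"
    unfolding resc[symmetric] using zero by simp
  from hyperbola_zero_normal_form[OF nn' this]
  obtain l where l: "0 \<le> l" and D: "d * v = - l - 2 * A - b" and E: "e / v = - l - 2 * C - b"
    and p: "p = A + C + b + 2 * l" and disc: "(b + l)\<^sup>2 \<le> 4 * A * C \<or> b + l < 0" .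
  note AC = nonneg_on_F_coeffs(1,2)[OF nn']
  have form: "qf a b c d e p x y = l * (1 - x * y) + A * (x / v - 1)\<^sup>2 + (b + l) * (x / v - 1) * (v * y - 1)
      + C * (v * y - 1)\<^sup>2" for x y
  proof -
    define X where "X = x / v"
    define Y where "Y = v * y"
    have xy: "x * y = X * Y" using v by (simp add: X_def Y_def)
    have "qf a b c d e p x y = qf A b C (d * v) (e / v) p X Y"
      using resc[of X Y] v by (simp add: X_def Y_def)
    also have "\<dots> = l * (1 - X * Y) + A * (X - 1)\<^sup>2 + (b + l) * (X - 1) * (Y - 1) + C * (Y - 1)\<^sup>2"
      unfolding D E p by (simp add: qf_def algebra_simps power2_eq_square)
    finally show ?thesis unfolding xy X_def Y_def .
  qed
  show ?thesis
  proof (cases "(b + l)\<^sup>2 \<le> 4 * A * C")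
    case True
    have "decomp (\<lambda>x y. l * (1 - x * y) + (A * (1 / v * x - 1)\<^sup>2 + (b + l) * (1 / v * x - 1) * (v * y - 1)
      + C * (v * y - 1)\<^sup>2))"
      using l AC True
      by (intro decomp.add decomp.scale decomp.gen generator.hyperbola decomp_psd_form) auto
    then show ?thesis by (rule decomp_cong) (simp add: form)
  next
    case False
    then have neg: "b + l < 0" using disc by auto
    define \<beta> where "\<beta> = - (b + l)"
    have \<beta>_eq: "b + l = - \<beta>" by (simp add: \<beta>_def)
    have \<beta>: "0 < \<beta>" "4 * A * C < \<beta>\<^sup>2" "4 * C * A < \<beta>\<^sup>2"
      using neg False unfolding \<beta>_def power2_minus by (auto simp: mult_ac)
    have axis: "0 \<le> l + A * s\<^sup>2 - \<beta> * s + C" if "0 \<le> s" "s \<le> 1" for s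
      using nonneg_on_FD[OF nn', of "1 - s" 0] that unfolding D E p
      by (simp add: qf_def \<beta>_def algebra_simps power2_eq_square)
    have axis': "0 \<le> l + C * s\<^sup>2 - \<beta> * s + A" if "0 \<le> s" "s \<le> 1" for s
      using nonneg_on_FD[OF nn', of 0 "1 - s"] that unfolding D E p
      by (simp add: qf_def \<beta>_def algebra_simps power2_eq_square)
    have form': "qf a b c d e p x y = l * (1 - x * y) + A * (x / v - 1)\<^sup>2 - \<beta> * (x / v - 1) * (v * y - 1)
      + C * (v * y - 1)\<^sup>2" for x y
      unfolding form \<beta>_eq by simp
    show ?thesis
    proof (cases "C \<le> A")
      case True
      from decomp_hyperbola_form[OF v AC(2) True \<beta>(1,2) axis] show ?thesis
        by (rule decomp_cong) (simp_all add: form')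
    next
      case False
      then have "A \<le> C" "0 < 1 / v" using v by auto
      from decomp_hyperbola_form[OF this(2) AC(1) this(1) \<beta>(1,3) axis', THEN decomp_swap] show ?thesis
        by (rule decomp_cong) (use v in \<open>simp_all add: form' field_simps\<close>)
    qed
  qed
qed

section \<open>Decomposition of nonnegative quadratics\<close>

text \<open>For \<open>x > 0\<close> the fibre ends at \<open>y = 0\<close> and
  \<open>y = 1 / x\<close>, and an affine function is controlled by its end values; the second
  hypothesis is \<open>x\<close> times the value at the upper end. At \<open>x = 0\<close> it reads
  \<open>0 \<le> e\<close>, as the unbounded fibre requires.\<close>

lemma nonneg_on_F_linear_snd:
  assumes f0: "\<And>x. 0 \<le> x \<Longrightarrow> 0 \<le> a * x\<^sup>2 + d * x + p"
    and f1: "\<And>x. 0 \<le> x \<Longrightarrow> 0 \<le> x * (a * x\<^sup>2 + d * x + p + b) + e"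
  shows "nonneg_on_F (qf a b 0 d e p)"
  unfolding nonneg_on_F_def
proof (intro allI impI)
  fix x y :: real assume xy: "0 \<le> x" "0 \<le> y" "x * y \<le> 1"
  have "qf a b 0 d e p x y
      = (1 - x * y) * (a * x\<^sup>2 + d * x + p) + y * (x * (a * x\<^sup>2 + d * x + p + b) + e)"
    by (simp add: qf_def algebra_simps)
  also have "0 \<le> \<dots>" using xy f0 f1 by simp
  finally show "0 \<le> qf a b 0 d e p x y" .
qed

lemma quadratic_eventually_nonneg:
  fixes a d k :: real
  assumes "0 < a \<or> (a = 0 \<and> 0 < d)"
  obtains N where "0 < N" "\<And>x. N \<le> x \<Longrightarrow> 0 \<le> a * x\<^sup>2 + d * x + k"
proof (cases "0 < a")
  case True
  define N where "N = 1 + (\<bar>d\<bar> + \<bar>k\<bar>) / a"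
  have N: "1 \<le> N" using True by (simp add: N_def)
  have "0 \<le> a * x\<^sup>2 + d * x + k" if x: "N \<le> x" for x
  proof -
    have "a * N \<le> a * x" using x True by simp
    moreover have "a * N = a + \<bar>d\<bar> + \<bar>k\<bar>" using True by (simp add: N_def field_simps)
    ultimately have "0 \<le> x * (a * x - \<bar>d\<bar> - \<bar>k\<bar>)" using x N True by (intro mult_nonneg_nonneg) auto
    moreover have "- (\<bar>d\<bar> * x) \<le> d * x"
      using mult_right_mono[of "- \<bar>d\<bar>" d x] x N by simp
    moreover have "\<bar>k\<bar> * 1 \<le> \<bar>k\<bar> * x" using x N by (intro mult_left_mono) auto
    ultimately show ?thesis by (simp add: algebra_simps power2_eq_square)
  qed
  then show thesis using that[of N] N by auto
next
  case False
  then have d: "a = 0" "0 < d" using assms by auto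
  have "0 \<le> a * x\<^sup>2 + d * x + k" if "1 + \<bar>k\<bar> / d \<le> x" for x
  proof -
    have "d * (1 + \<bar>k\<bar> / d) \<le> d * x" using that d by simp
    moreover have "d * (1 + \<bar>k\<bar> / d) = d + \<bar>k\<bar>" using d by (simp add: field_simps)
    ultimately show ?thesis using d by simp
  qed
  then show thesis using that[of "1 + \<bar>k\<bar> / d"] d by (simp add: add_pos_nonneg)
qed

text \<open>Subtracting multiples of \<open>y\<close> and \<open>x * y\<close> leaves the axis part
  \<open>f0\<close> unchanged and lowers the cubic \<open>f1\<close>. Either \<open>f1\<close> can
  be brought to touch 0 at a positive point, which is a zero on the hyperbola, or the coefficients
  are visibly nonnegative.\<close>

lemma decomp_linear_snd:
  assumes nn: "nonneg_on_F (qf a b 0 d e p)"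
  shows "decomp (qf a b 0 d e p)"
proof -
  define f0 where "f0 x = a * x\<^sup>2 + d * x + p" for x
  define f1 where "f1 x = x * (f0 x + b) + e" for x
  note a = nonneg_on_F_coeffs(1)[OF nn] and d = nonneg_on_F_coeffs(4)[OF nn]
    and p = nonneg_on_F_coeffs(3)[OF nn]
  have e: "0 \<le> e" using nonneg_on_F_coeffs(5)[OF nn] by simp
  have f0: "0 \<le> f0 x" if "0 \<le> x" for x
    using nonneg_on_F_axis[OF nn that] by (simp add: f0_def)
  have f1: "0 \<le> f1 x" if "0 \<le> x" for x
  proof (cases "x = 0")
    case False
    then have "0 \<le> x * qf a b 0 d e p x (1 / x)"
      using that by (intro mult_nonneg_nonneg nonneg_on_FD[OF nn]) auto
    also have "\<dots> = f1 x" using False by (simp add: f1_def f0_def qf_def field_simps)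
    finally show ?thesis .
  qed (simp add: f1_def e)
  have touching: "decomp (qf a b' 0 d e' p)"
    if "\<And>x. 0 \<le> x \<Longrightarrow> 0 \<le> x * (f0 x + b') + e'" "0 < v" "v * (f0 v + b') + e' = 0" for b' e' v
  proof (rule decomp_hyperbola_zero)
    show "nonneg_on_F (qf a b' 0 d e' p)"
      by (rule nonneg_on_F_linear_snd) (use f0 that(1) in \<open>simp_all add: f0_def\<close>)
    have "qf a b' 0 d e' p v (1 / v) = (v * (f0 v + b') + e') / v"
      using that(2) by (simp add: qf_def f0_def field_simps)
    then show "qf a b' 0 d e' p v (1 / v) = 0" using that(3) by simp
  qed (rule that(2))
  have monotone: ?thesis if "0 \<le> d" "0 \<le> b + p"
  proof -
    have "decomp (\<lambda>x y. a * x\<^sup>2 + (b + p) * (x * y) + 0 * y\<^sup>2 + d * x + e * y + p * (1 - x * y))"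
      using that a e p by (intro decomp_nonneg_coeffs) auto
    then show ?thesis by (rule decomp_cong) (simp add: qf_def algebra_simps)
  qed
  show ?thesis
  proof (cases "0 < a \<or> (a = 0 \<and> 0 < d)")
    case False
    then have ad: "a = 0" "d = 0" using a d by auto
    have "0 \<le> (b + p) + e * 0"
    proof (rule nonneg_limit[of "\<lambda>t. (b + p) + e * t" 1])
      fix t :: real assume t: "0 < t"
      have "0 \<le> t * f1 (1 / t)" using f1[of "1 / t"] t by simp
      also have "\<dots> = (b + p) + e * t" using t by (simp add: f1_def f0_def ad field_simps)
      finally show "0 \<le> (b + p) + e * t" .
    qed auto
    then show ?thesis using monotone ad by simp
  next
    case True
    \<comment> \<open>Beyond \<open>N\<close> the cubic \<open>f1\<close> is at least
      \<open>f1 0\<close>, so its minimum on \<open>[0, N]\<close> is global.\<close>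
    then obtain N where N: "0 < N" "\<And>x. N \<le> x \<Longrightarrow> 0 \<le> a * x\<^sup>2 + d * x + (p + b)"
      using quadratic_eventually_nonneg by blast
    have "continuous_on {0..N} f1" unfolding f1_def f0_def by (intro continuous_intros)
    then obtain m where m: "0 \<le> m" "m \<le> N" "\<And>x. 0 \<le> x \<Longrightarrow> x \<le> N \<Longrightarrow> f1 m \<le> f1 x"
      using continuous_attains_inf[of "{0..N}" f1] N(1) by auto
    have min: "f1 m \<le> f1 x" if x: "0 \<le> x" for x
    proof (cases "x \<le> N")
      case False
      then have "0 \<le> x * (a * x\<^sup>2 + d * x + (p + b))" using N x by (intro mult_nonneg_nonneg) auto
      then have "f1 0 \<le> f1 x" by (simp add: f1_def f0_def algebra_simps)
      then show ?thesis using m(3)[of 0] N(1) by simp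
    qed (use m x in auto)
    show ?thesis
    proof (cases "m = 0")
      case False
      have "decomp (qf a b 0 d (e - f1 m) p)"
        by (rule touching[where v = m]) (use min m(1) False in \<open>auto simp: f1_def algebra_simps\<close>)
      then have "decomp (\<lambda>x y. qf a b 0 d (e - f1 m) p x y + f1 m * y)"
        using f1[OF m(1)] by (rule decomp.add[OF _ decomp.scale[OF _ decomp.gen[OF generator.coord_snd]]])
      then show ?thesis by (rule decomp_cong) (simp add: qf_def algebra_simps)
    next
      case True
      have f0b: "0 \<le> f0 x + b" if "0 < x" for x
        using min[of x] that True by (simp add: f1_def zero_le_mult_iff)
      have "0 \<le> f0 0 + b"
      proof (rule nonneg_limit[OF _ zero_less_one, of "\<lambda>x. f0 x + b"])
        show "isCont (\<lambda>x. f0 x + b) 0" unfolding f0_def by simp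
      qed (rule f0b)
      then have bp: "0 \<le> b + p" by (simp add: f0_def)
      show ?thesis
      proof (cases "0 \<le> d")
        case False
        then have a: "0 < a" using a d by fastforce
        \<comment> \<open>The vertex of \<open>f0\<close>. Removing \<open>e * y\<close> and
          \<open>k * (x * y)\<close>, with \<open>k\<close> the minimum of \<open>f0 + b\<close>,
          leaves the cubic \<open>a * x * (x - v)\<^sup>2\<close>, which touches 0 at
          \<open>v\<close>.\<close>
        define v where "v = - d / (2 * a)"
        have v: "0 < v" and d_eq: "d = - 2 * a * v"
          using a False by (auto simp: v_def divide_simps)
        define k where "k = f0 v + b"
        have k: "0 \<le> k" using f0b[OF v] by (simp add: k_def)
        have sq: "f0 x + (b - k) = a * (x - v)\<^sup>2" for x
          unfolding k_def f0_def d_eq by (simp add: algebra_simps power2_eq_square)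
        have "decomp (qf a (b - k) 0 d 0 p)"
          by (rule touching[OF _ v]) (use a sq in auto)
        then have "decomp (\<lambda>x y. qf a (b - k) 0 d 0 p x y + (k * (x * y) + e * y))"
          by (rule decomp.add)
            (intro decomp.add decomp.scale decomp.gen generator.coord_snd generator.coord_prod k e)
        then show ?thesis by (rule decomp_cong) (simp add: qf_def algebra_simps)
      qed (use monotone bp in auto)
    qed
  qed
qed

section \<open>Both pure squares present: compactness and limiting zeros\<close>

text \<open>Since \<open>x * y\<close> is bounded and the part in \<open>y\<close> alone is bounded
  below, \<open>a * x\<^sup>2\<close> is at most a constant plus \<open>|d| * x\<close>. This
  supplies compactness although the region is unbounded.\<close>

lemma small_value_bounded:
  assumes ac: "0 < a" "0 < c" and xy: "0 \<le> x" "0 \<le> y" "x * y \<le> 1"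
    and le: "qf a b c d e p x y \<le> 1"
  shows "x \<le> 1 + (1 + \<bar>b\<bar> + \<bar>p\<bar> + e\<^sup>2 / (4 * c) + \<bar>d\<bar>) / a"
proof (cases "x \<le> 1")
  case True
  then show ?thesis using ac by (smt (verit) divide_nonneg_pos zero_le_power2)
next
  case False
  define M where "M = 1 + \<bar>b\<bar> + \<bar>p\<bar> + e\<^sup>2 / (4 * c)"
  have "0 \<le> c * (y + e / (2 * c))\<^sup>2" using ac by simp
  also have "\<dots> = c * y\<^sup>2 + e * y + e\<^sup>2 / (4 * c)"
    using ac by (simp add: field_simps power2_eq_square)
  finally have 1: "- (e\<^sup>2 / (4 * c)) \<le> c * y\<^sup>2 + e * y" by simp
  have "\<bar>b * (x * y)\<bar> \<le> \<bar>b\<bar> * 1" unfolding abs_mult using xy by (intro mult_left_mono) auto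
  then have 2: "- \<bar>b\<bar> \<le> b * x * y" by (simp add: mult.assoc)
  have 3: "- (\<bar>d\<bar> * x) \<le> d * x" using mult_right_mono[of "- \<bar>d\<bar>" d x] xy by simp
  have "a * x\<^sup>2 \<le> M + \<bar>d\<bar> * x" using le 1 2 3 unfolding qf_def M_def by linarith
  moreover have "M * 1 \<le> M * x" using False ac by (intro mult_left_mono) (auto simp: M_def)
  ultimately have "x * (a * x) \<le> x * (M + \<bar>d\<bar>)" by (simp add: algebra_simps power2_eq_square)
  then have "a * x \<le> M + \<bar>d\<bar>" using False by simp
  then have "x \<le> (M + \<bar>d\<bar>) / a" using ac by (simp add: field_simps)
  then show ?thesis by (simp add: M_def)
qed

text \<open>The sequences say that no further multiple of \<open>x * y\<close> can be subtracted
  near the zero. This excludes a positive derivative across the axis, so the polynomial is a pure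
  form around \<open>(u, 0)\<close>, and this form is semidefinite.\<close>

lemma decomp_zero_on_axis:
  assumes nn: "nonneg_on_F (qf a b c d e p)" and ac: "0 < a" "0 < c" and u: "0 < u"
    and zero: "qf a b c d e p u 0 = 0"
    and lim: "X \<longlonglongrightarrow> u" "\<epsilon> \<longlonglongrightarrow> 0"
    and XY: "\<And>n. 0 < X n" "\<And>n. 0 < Y n" "\<And>n. qf a b c d e p (X n) (Y n) < \<epsilon> n * (X n * Y n)"
  shows "decomp (qf a b c d e p)"
proof -
  have p: "p = - a * u\<^sup>2 - d * u" using zero by (simp add: qf_def)
  have "0 \<le> t * (2 * a * u + d + a * t)" if "- u < t" for t
    using nonneg_on_F_axis[OF nn, of "u + t"] that unfolding p
    by (simp add: algebra_simps power2_eq_square)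
  then have der: "0 \<le> 2 * a * u + d + a * t" "0 \<le> - (2 * a * u + d) + a * t" if "0 < t" "t < u" for t
    using that by (smt (verit) zero_le_mult_iff mult_minus_right)+
  have "0 \<le> 2 * a * u + d + a * 0"
    by (rule nonneg_limit[OF _ u, of "\<lambda>t. 2 * a * u + d + a * t"]) (auto intro: der)
  moreover have "0 \<le> - (2 * a * u + d) + a * 0"
    by (rule nonneg_limit[OF _ u, of "\<lambda>t. - (2 * a * u + d) + a * t"]) (use der in auto)
  ultimately have d: "d = - 2 * a * u" by simp
  \<comment> \<open>The derivative across the axis at \<open>(u, 0)\<close>: the sequence gives
    \<open>E \<le> 0\<close>, the region above the axis gives \<open>0 \<le> E\<close>.\<close>
  define E where "E = e + b * u"
  have form: "qf a b c d e p x y = a * (x - u)\<^sup>2 + b * (x - u) * y + c * y\<^sup>2 + E * y" for x y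
    unfolding p d E_def by (simp add: qf_def algebra_simps power2_eq_square)
  have "E + b * (X n - u) \<le> \<epsilon> n * X n" for n
  proof -
    have "0 \<le> a * (X n - u)\<^sup>2 + c * (Y n)\<^sup>2" using ac by simp
    then have "Y n * (E + b * (X n - u)) \<le> Y n * (\<epsilon> n * X n)"
      using XY(3)[of n] unfolding form by (simp add: algebra_simps)
    then show ?thesis using XY(2)[of n] by simp
  qed
  then have "E + b * (u - u) \<le> 0 * u"
    by (intro LIMSEQ_le[of "\<lambda>n. E + b * (X n - u)" _ "\<lambda>n. \<epsilon> n * X n"] tendsto_intros lim) auto
  moreover have "0 \<le> E + c * 0"
  proof (rule nonneg_limit[of "\<lambda>t. E + c * t" "1 / u"])
    fix t assume t: "0 < t" "t < 1 / u"
    have "0 \<le> qf a b c d e p u t"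
      using t u by (intro nonneg_on_FD[OF nn]) (auto simp: field_simps)
    also have "\<dots> = t * (E + c * t)" by (simp add: form algebra_simps power2_eq_square)
    finally show "0 \<le> E + c * t" using t by (simp add: zero_le_mult_iff)
  qed (use u in auto)
  ultimately have E: "E = 0" by simp
  \<comment> \<open>Small enough that \<open>(u - b * s, 2 * a * s)\<close> lies in the region. The
    displacement \<open>(- b, 2 * a)\<close> points upwards and reveals the discriminant.\<close>
  define s where "s = min (u / (\<bar>b\<bar> + 1)) (1 / (4 * a * u))"
  have s: "0 < s" using u ac by (simp add: s_def)
  have "s \<le> u / (\<bar>b\<bar> + 1)" "s \<le> 1 / (4 * a * u)" unfolding s_def by simp_all
  then have bs: "\<bar>b\<bar> * s \<le> u" and as: "2 * u * (2 * a * s) \<le> 1"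
    using u ac s by (auto simp: field_simps)
  have "\<bar>b * s\<bar> \<le> u" using bs s by (simp add: abs_mult)
  then have x: "0 \<le> u - b * s" "u - b * s \<le> 2 * u" by linarith+
  have "(u - b * s) * (2 * a * s) \<le> 2 * u * (2 * a * s)"
    using x s ac by (intro mult_right_mono) auto
  then have "(u - b * s) * (2 * a * s) \<le> 1" using as by linarith
  then have "0 \<le> qf a b c d e p (u - b * s) (2 * a * s)"
    using x s ac by (intro nonneg_on_FD[OF nn]) auto
  also have "\<dots> = s\<^sup>2 * a * (4 * a * c - b\<^sup>2)"
    by (simp add: form E algebra_simps power2_eq_square)
  finally have "0 \<le> s\<^sup>2 * a * (4 * a * c - b\<^sup>2)" .
  moreover have "0 < s\<^sup>2 * a" using s ac by simp
  ultimately have "b\<^sup>2 \<le> 4 * a * c" by (smt (verit) mult_pos_neg)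
  with ac have "decomp (\<lambda>x y. a * (1 * x - u)\<^sup>2 + b * (1 * x - u) * (1 * y - 0) + c * (1 * y - 0)\<^sup>2)"
    by (intro decomp_psd_form) auto
  then show ?thesis by (rule decomp_cong) (simp add: form E)
qed

text \<open>The axes make both first order coefficients nonnegative, and the sequence then forces
  them to vanish. The remaining form has nonnegative coefficients or is tested along
  \<open>(- b, 2 * a)\<close>, which for \<open>b < 0\<close> points into the quadrant.\<close>

lemma decomp_zero_at_origin:
  assumes nn: "nonneg_on_F (qf a b c d e 0)" and ac: "0 < a" "0 < c"
    and lim: "X \<longlonglongrightarrow> 0" "Y \<longlonglongrightarrow> 0" "\<epsilon> \<longlonglongrightarrow> 0"
    and XY: "\<And>n. 0 < X n" "\<And>n. 0 < Y n" "\<And>n. qf a b c d e 0 (X n) (Y n) < \<epsilon> n * (X n * Y n)"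
  shows "decomp (qf a b c d e 0)"
proof -
  \<comment> \<open>Used for both coordinates; each application supplies the premise
    \<open>0 \<le> e\<close> of the other.\<close>
  have half: "0 \<le> d \<and> (0 \<le> e \<longrightarrow> d \<le> 0)"
    if nn: "nonneg_on_F (qf a b c d e 0)" and ac: "0 < a" "0 < c"
    and lim: "Y \<longlonglongrightarrow> 0" "\<epsilon> \<longlonglongrightarrow> 0"
    and XY: "\<And>n. 0 < X n" "\<And>n. 0 < Y n" "\<And>n. qf a b c d e 0 (X n) (Y n) < \<epsilon> n * (X n * Y n)"
    for a c d e and X Y \<epsilon> :: "nat \<Rightarrow> real"
  proof
    have "0 \<le> d + a * 0"
    proof (rule nonneg_limit[of "\<lambda>t. d + a * t" 1])
      fix t :: real assume t: "0 < t"
      have "0 \<le> t * (d + a * t)"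
        using nonneg_on_F_axis[OF nn, of t] t by (simp add: algebra_simps power2_eq_square)
      then show "0 \<le> d + a * t" using t by (simp add: zero_le_mult_iff)
    qed auto
    then show "0 \<le> d" by simp
    show "0 \<le> e \<longrightarrow> d \<le> 0"
    proof
      assume e: "0 \<le> e"
      have "d + b * Y n \<le> \<epsilon> n * Y n" for n
      proof -
        have "0 \<le> a * (X n)\<^sup>2 + c * (Y n)\<^sup>2 + e * Y n" using ac e XY(2)[of n] by simp
        then have "X n * (d + b * Y n) \<le> X n * (\<epsilon> n * Y n)"
          using XY(3)[of n] unfolding qf_def by (simp add: algebra_simps)
        then show ?thesis using XY(1)[of n] by simp
      qed
      then have "d + b * 0 \<le> 0 * 0"
        by (intro LIMSEQ_le[of "\<lambda>n. d + b * Y n" _ "\<lambda>n. \<epsilon> n * Y n"] tendsto_intros lim) auto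
      then show "d \<le> 0" by simp
    qed
  qed
  have "qf c b a e d 0 (Y n) (X n) < \<epsilon> n * (Y n * X n)" for n
    using XY(3)[of n] by (simp add: qf_swap[of c] mult.commute)
  from half[OF nn ac lim(2,3) XY] half[OF nonneg_on_F_swap[OF nn] ac(2,1) lim(1,3) XY(2,1) this]
  have de: "d = 0" "e = 0" by auto
  show ?thesis
  proof (cases "0 \<le> b")
    case True
    have "decomp (\<lambda>x y. a * x\<^sup>2 + b * (x * y) + c * y\<^sup>2 + 0 * x + 0 * y + 0 * (1 - x * y))"
      using True ac by (intro decomp_nonneg_coeffs) auto
    then show ?thesis by (rule decomp_cong) (simp add: qf_def de)
  next
    case False
    define s where "s = 1 / (1 + 2 * a * (- b))"
    have D: "1 \<le> 1 + 2 * a * (- b)" using ac False by (simp add: mult_nonneg_nonpos)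
    then have s: "0 < s" "s \<le> 1" by (auto simp: s_def)
    have "2 * a * (- b) * s \<le> 1" using D by (simp add: s_def field_simps)
    then have "(2 * a * (- b) * s) * s \<le> 1 * 1" using s D by (intro mult_mono) auto
    then have "0 \<le> qf a b c d e 0 (- b * s) (2 * a * s)"
      using False ac s by (intro nonneg_on_FD[OF nn]) (auto simp: mult_ac mult_nonpos_nonneg)
    also have "\<dots> = s\<^sup>2 * a * (4 * a * c - b\<^sup>2)"
      by (simp add: qf_def de algebra_simps power2_eq_square)
    finally have "0 \<le> s\<^sup>2 * a * (4 * a * c - b\<^sup>2)" .
  moreover have "0 < s\<^sup>2 * a" using s ac by simp
  ultimately have "b\<^sup>2 \<le> 4 * a * c" by (smt (verit) mult_pos_neg)
    with ac have "decomp (\<lambda>x y. a * (1 * x - 0)\<^sup>2 + b * (1 * x - 0) * (1 * y - 0) + c * (1 * y - 0)\<^sup>2)"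
      by (intro decomp_psd_form) auto
    then show ?thesis by (rule decomp_cong) (simp add: qf_def de)
  qed
qed

lemma decomp_interior_zero:
  assumes nn: "nonneg_on_F (qf a b c d e p)" and z: "0 < z1" "0 < z2" "z1 * z2 < 1"
    and zero: "qf a b c d e p z1 z2 = 0"
  shows "decomp (qf a b c d e p)"
proof -
  note q = interior_zero[OF nn z zero]
  have "decomp (\<lambda>x y. a * (1 * x - z1)\<^sup>2 + b * (1 * x - z1) * (1 * y - z2) + c * (1 * y - z2)\<^sup>2)"
    using q by (intro decomp_psd_form)
  then show ?thesis by (rule decomp_cong) (simp add: q(4))
qed

lemma decomp_positive_squares:
  assumes nn: "nonneg_on_F (qf a b c d e p)" and ac: "0 < a" "0 < c"
  shows "decomp (qf a b c d e p)"
proof -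
  \<comment> \<open>The infimum of these quotients is the largest multiple of \<open>x * y\<close>
    that can be subtracted; on the axes the subtraction changes nothing.\<close>
  define S where "S = {qf a b c d e p x y / (x * y) |x y. 0 < x \<and> 0 < y \<and> x * y \<le> 1}"
  define t where "t = Inf S"
  have "qf a b c d e p 1 1 / (1 * 1) \<in> S"
    unfolding S_def by (intro CollectI exI[of _ 1] conjI) auto
  then have ne: "S \<noteq> {}" by blast
  have S0: "0 \<le> s" if "s \<in> S" for s
    using that by (auto simp: S_def intro!: divide_nonneg_pos nonneg_on_FD[OF nn])
  have t0: "0 \<le> t" unfolding t_def by (rule cInf_greatest[OF ne S0])
  have bdd: "bdd_below S" using S0 by (auto simp: bdd_below_def)
  define B where "B = b - t"
  have q_eq: "qf a B c d e p x y = qf a b c d e p x y - t * (x * y)" for x y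
    by (simp add: B_def qf_def algebra_simps)
  have nn': "nonneg_on_F (qf a B c d e p)"
    unfolding nonneg_on_F_def
  proof (intro allI impI)
    fix x y :: real assume xy: "0 \<le> x" "0 \<le> y" "x * y \<le> 1"
    have q: "0 \<le> qf a b c d e p x y" using nonneg_on_FD[OF nn xy] .
    show "0 \<le> qf a B c d e p x y"
    proof (cases "x = 0 \<or> y = 0")
      case True
      then show ?thesis using q by (auto simp: q_eq)
    next
      case False
      then have pos: "0 < x" "0 < y" using xy by auto
      then have "t \<le> qf a b c d e p x y / (x * y)"
        unfolding t_def using xy by (intro cInf_lower bdd) (auto simp: S_def)
      then show ?thesis using pos by (simp add: q_eq field_simps)
    qed
  qed
  \<comment> \<open>By the choice of \<open>t\<close>, subtracting a further
    \<open>1 / (n + 1)\<close> times \<open>x * y\<close> fails at some point; the limit of a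
    subsequence of such points is the required zero.\<close>
  have "\<exists>x y. 0 < x \<and> 0 < y \<and> x * y \<le> 1 \<and> qf a B c d e p x y < inverse (real (Suc n)) * (x * y)" for n
  proof -
    have "Inf S < t + inverse (real (Suc n))" by (simp add: t_def)
    then obtain s where "s \<in> S" "s < t + inverse (real (Suc n))" using cInf_lessD[OF ne] by blast
    then obtain x y where xy: "0 < x" "0 < y" "x * y \<le> 1"
      and less: "qf a b c d e p x y / (x * y) < t + inverse (real (Suc n))"
      unfolding S_def by blast
    have "qf a b c d e p x y < (t + inverse (real (Suc n))) * (x * y)"
      using less xy by (simp add: pos_divide_less_eq)
    then show ?thesis using xy unfolding q_eq by (intro exI[of _ x] exI[of _ y]) (simp add: algebra_simps)
  qed
  then obtain X Y where X: "\<And>n. 0 < X n" and Y: "\<And>n. 0 < Y n" and XY: "\<And>n. X n * Y n \<le> (1::real)"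
    and small: "\<And>n. qf a B c d e p (X n) (Y n) < inverse (real (Suc n)) * (X n * Y n)"
    by metis
  define K where "K = (1 + (1 + \<bar>B\<bar> + \<bar>p\<bar> + e\<^sup>2 / (4 * c) + \<bar>d\<bar>) / a)"
  define L where "L = (1 + (1 + \<bar>B\<bar> + \<bar>p\<bar> + d\<^sup>2 / (4 * a) + \<bar>e\<bar>) / c)"
  have bounded: "(X n, Y n) \<in> {0..K} \<times> {0..L}" for n
  proof -
    have "inverse (real (Suc n)) * (X n * Y n) \<le> 1 * 1"
      using X[of n] Y[of n] XY[of n] by (intro mult_mono) (auto simp: field_simps)
    then have le: "qf a B c d e p (X n) (Y n) \<le> 1" using small[of n] by simp
    have "X n \<le> K" unfolding K_def
      using small_value_bounded[OF ac _ _ _ le] X[of n] Y[of n] XY[of n] by simp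
    moreover have "Y n \<le> L" unfolding L_def
      using small_value_bounded[OF ac(2,1) _ _ _ le[unfolded qf_swap[of a]]] X[of n] Y[of n] XY[of n]
      by (simp add: mult.commute)
    ultimately show ?thesis using X[of n] Y[of n] by simp
  qed
  have "compact ({0..K} \<times> {0..L})" by (intro compact_Times compact_Icc)
  then obtain z r where z: "z \<in> {0..K} \<times> {0..L}" and r: "strict_mono (r :: nat \<Rightarrow> nat)"
    and lim: "((\<lambda>n. (X n, Y n)) \<circ> r) \<longlonglongrightarrow> z"
    using bounded unfolding compact_def by meson
  obtain u w where zuw: "z = (u, w)" by (cases z)
  define X' where "X' n = X (r n)" for n
  define Y' where "Y' n = Y (r n)" for n
  define \<epsilon> where "\<epsilon> n = inverse (real (Suc (r n)))" for n
  have uw: "0 \<le> u" "0 \<le> w" using z zuw by auto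
  have X'lim: "X' \<longlonglongrightarrow> u" and Y'lim: "Y' \<longlonglongrightarrow> w"
    using tendsto_fst[OF lim] tendsto_snd[OF lim] by (simp_all add: zuw o_def X'_def[abs_def] Y'_def[abs_def])
  have \<epsilon>lim: "\<epsilon> \<longlonglongrightarrow> 0"
    using LIMSEQ_subseq_LIMSEQ[OF LIMSEQ_inverse_real_of_nat r] by (simp add: o_def \<epsilon>_def[abs_def])
  have X': "0 < X' n" and Y': "0 < Y' n" and XY': "X' n * Y' n \<le> 1"
    and small': "qf a B c d e p (X' n) (Y' n) < \<epsilon> n * (X' n * Y' n)" for n
    using X Y XY small by (simp_all add: X'_def Y'_def \<epsilon>_def)
  have uw1: "u * w \<le> 1"
    by (rule LIMSEQ_le_const2[OF tendsto_mult[OF X'lim Y'lim]]) (use XY' in auto)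
  have "qf a B c d e p u w \<le> 0 * (u * w)"
  proof (rule LIMSEQ_le)
    show "(\<lambda>n. qf a B c d e p (X' n) (Y' n)) \<longlonglongrightarrow> qf a B c d e p u w"
      unfolding qf_def by (intro tendsto_intros X'lim Y'lim)
    show "(\<lambda>n. \<epsilon> n * (X' n * Y' n)) \<longlonglongrightarrow> 0 * (u * w)"
      by (intro tendsto_intros X'lim Y'lim \<epsilon>lim)
  qed (use small' in \<open>auto intro: less_imp_le\<close>)
  then have zero: "qf a B c d e p u w = 0"
    using nonneg_on_FD[OF nn' uw uw1] by simp
  have "decomp (qf a B c d e p)"
  proof -
    \<comment> \<open>Only for a limit on an axis does the sequence enter again, to exclude first
      order terms.\<close>
    consider "0 < u" "0 < w" "u * w < 1" | "0 < u" "u * w = 1" | "0 < u" "w = 0" | "u = 0" "0 < w" | "u = 0" "w = 0"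
      using uw uw1 by fastforce
    then show ?thesis
    proof cases
      case 1
      then show ?thesis using decomp_interior_zero[OF nn' _ _ _ zero] by blast
    next
      case 2
      then have "w = 1 / u" by (simp add: field_simps)
      then show ?thesis using decomp_hyperbola_zero[OF nn' 2(1)] zero by blast
    next
      case 3
      then show ?thesis
        using decomp_zero_on_axis[OF nn' ac _ _ X'lim \<epsilon>lim X' Y' small'] zero by simp
    next
      case 4
      have "qf c B a e d p w 0 = 0" using zero 4 by (simp add: qf_swap[of c])
      moreover have "qf c B a e d p (Y' n) (X' n) < \<epsilon> n * (Y' n * X' n)" for n
        using small'[of n] by (simp add: qf_swap[of c] mult.commute)
      ultimately have "decomp (qf c B a e d p)"
        by (rule decomp_zero_on_axis[where X = Y' and Y = X' and \<epsilon> = \<epsilon>,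
            OF nonneg_on_F_swap[OF nn'] ac(2,1) 4(2) _ Y'lim \<epsilon>lim Y' X'])
      then show ?thesis by (rule decomp_qf_swap)
    next
      case 5
      then have "p = 0" using zero by (simp add: qf_def)
      then show ?thesis
        using decomp_zero_at_origin[OF _ ac _ _ \<epsilon>lim X' Y'] nn' X'lim Y'lim small' 5 by simp
    qed
  qed
  then have "decomp (\<lambda>x y. qf a B c d e p x y + t * (x * y))"
    using t0 by (rule decomp.add[OF _ decomp.scale[OF _ decomp.gen[OF generator.coord_prod]]])
  then show ?thesis by (rule decomp_cong) (simp add: q_eq)
qed

lemma decomp_nonneg:
  assumes nn: "nonneg_on_F (qf a b c d e p)"
  shows "decomp (qf a b c d e p)"
proof -
  consider "c = 0" | "a = 0" | "0 < a" "0 < c"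
    using nonneg_on_F_coeffs(1,2)[OF nn] by fastforce
  then show ?thesis
  proof cases
    case 1
    then show ?thesis using decomp_linear_snd nn by simp
  next
    case 2
    then show ?thesis using decomp_linear_snd[of c b e d p] nonneg_on_F_swap[OF nn] decomp_qf_swap by simp
  qed (use nn decomp_positive_squares in blast)
qed

section \<open>Extremality of the generators\<close>

text \<open>One summand is tested and the other is the difference, so extremality can be checked on
  coefficients.\<close>

definition extremal :: "(real \<Rightarrow> real \<Rightarrow> real) \<Rightarrow> bool" where
  "extremal g \<longleftrightarrow> (\<forall>a b c d e p. nonneg_on_F (qf a b c d e p) \<longrightarrow>
     nonneg_on_F (\<lambda>x y. g x y - qf a b c d e p x y) \<longrightarrow>
     (\<exists>k\<ge>0. \<forall>x y. qf a b c d e p x y = k * g x y))"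

lemma extremal_swap:
  assumes "extremal g" shows "extremal (\<lambda>x y. g y x)"
  unfolding extremal_def
proof (intro allI impI)
  fix a b c d e p
  assume "nonneg_on_F (qf a b c d e p)" "nonneg_on_F (\<lambda>x y. g y x - qf a b c d e p x y)"
  then have "nonneg_on_F (qf c b a e d p)" "nonneg_on_F (\<lambda>x y. g x y - qf c b a e d p x y)"
    by (simp_all add: nonneg_on_F_swap) (simp add: nonneg_on_F_def qf_swap[of c] mult.commute)
  then have "\<exists>k\<ge>0. \<forall>x y. qf c b a e d p x y = k * g x y"
    using assms unfolding extremal_def by blast
  then show "\<exists>k\<ge>0. \<forall>x y. qf a b c d e p x y = k * g y x"
    using qf_swap by metis
qed

lemma extremal_qfI:
  assumes g: "\<And>x y. g x y = qf A B C D E P x y"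
    and *: "\<And>a b c d e p. nonneg_on_F (qf a b c d e p) \<Longrightarrow>
      nonneg_on_F (qf (A - a) (B - b) (C - c) (D - d) (E - e) (P - p)) \<Longrightarrow>
      \<exists>k\<ge>0. a = k * A \<and> b = k * B \<and> c = k * C \<and> d = k * D \<and> e = k * E \<and> p = k * P"
  shows "extremal g"
  unfolding extremal_def
proof (intro allI impI)
  fix a b c d e p
  assume nn: "nonneg_on_F (qf a b c d e p)" "nonneg_on_F (\<lambda>x y. g x y - qf a b c d e p x y)"
  have "(\<lambda>x y. g x y - qf a b c d e p x y) = qf (A - a) (B - b) (C - c) (D - d) (E - e) (P - p)"
    by (intro ext) (simp add: g qf_def algebra_simps)
  then obtain k where "k \<ge> 0" "a = k * A" "b = k * B" "c = k * C" "d = k * D" "e = k * E" "p = k * P"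
    using *[OF nn(1)] nn(2) by metis
  then show "\<exists>k\<ge>0. \<forall>x y. qf a b c d e p x y = k * g x y"
    by (intro exI[of _ k]) (simp add: g qf_def algebra_simps)
qed

text \<open>Both summands vanish at the interior zero, hence are semidefinite forms around it. Their
  sum vanishes along the zero line, so the line direction \<open>(\<beta>, - \<alpha>)\<close> lies
  in the kernel of each, which leaves one free factor.\<close>

lemma extremal_affine_square:
  assumes z: "0 < z1" "0 < z2" "z1 * z2 < 1" and ne: "\<alpha> \<noteq> 0 \<or> \<beta> \<noteq> 0"
    and zero: "\<alpha> * z1 + \<beta> * z2 + \<gamma> = 0"
  shows "extremal (\<lambda>x y. (\<alpha> * x + \<beta> * y + \<gamma>)\<^sup>2)"
  unfolding extremal_def
proof (intro allI impI)
  fix a b c d e p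
  let ?g = "\<lambda>x y. (\<alpha> * x + \<beta> * y + \<gamma>)\<^sup>2"
  assume nn1: "nonneg_on_F (qf a b c d e p)"
    and nn2': "nonneg_on_F (\<lambda>x y. ?g x y - qf a b c d e p x y)"
  define a' b' c' d' e' p' where defs: "a' = \<alpha>\<^sup>2 - a" "b' = 2 * \<alpha> * \<beta> - b" "c' = \<beta>\<^sup>2 - c"
    "d' = 2 * \<alpha> * \<gamma> - d" "e' = 2 * \<beta> * \<gamma> - e" "p' = \<gamma>\<^sup>2 - p"
  have rest: "(\<lambda>x y. ?g x y - qf a b c d e p x y) = qf a' b' c' d' e' p'"
    by (intro ext) (simp add: qf_def defs algebra_simps power2_eq_square)
  note nn2 = nn2'[unfolded rest]
  have sum: "qf a b c d e p x y + qf a' b' c' d' e' p' x y = ?g x y" for x y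
    unfolding rest[symmetric] by simp
  have "0 \<le> qf a b c d e p z1 z2" "0 \<le> qf a' b' c' d' e' p' z1 z2"
    using z by (auto intro!: nonneg_on_FD[OF nn1] nonneg_on_FD[OF nn2])
  then have zeros: "qf a b c d e p z1 z2 = 0" "qf a' b' c' d' e' p' z1 z2 = 0"
    using sum[of z1 z2] zero by auto
  note q1 = interior_zero[OF nn1 z zeros(1)] and q2 = interior_zero[OF nn2 z zeros(2)]
  have psd: "0 \<le> a * m\<^sup>2 + b * m * n + c * n\<^sup>2"
    if "0 \<le> a" "0 \<le> c" "b\<^sup>2 \<le> 4 * a * c" for a b c m n :: real
  proof (cases "a = 0")
    case False
    have "0 \<le> (2 * a * m + b * n)\<^sup>2 + (4 * a * c - b\<^sup>2) * n\<^sup>2" using that by simp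
    also have "\<dots> = 4 * a * (a * m\<^sup>2 + b * m * n + c * n\<^sup>2)"
      by (simp add: algebra_simps power2_eq_square)
    finally show ?thesis using that False by (simp add: zero_le_mult_iff)
  qed (use that in auto)
  \<comment> \<open>This point may leave the region, but the forms are nonnegative on the whole
    plane.\<close>
  have "?g (z1 + \<beta>) (z2 - \<alpha>) = (\<alpha> * z1 + \<beta> * z2 + \<gamma>)\<^sup>2" by (simp add: algebra_simps)
  then have "?g (z1 + \<beta>) (z2 - \<alpha>) = 0" using zero by simp
  then have "a * \<beta>\<^sup>2 + b * \<beta> * (- \<alpha>) + c * (- \<alpha>)\<^sup>2 = 0"
    using sum[of "z1 + \<beta>" "z2 - \<alpha>"] psd[OF q1(1-3), of \<beta> "- \<alpha>"] psd[OF q2(1-3), of \<beta> "- \<alpha>"]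
    unfolding q1(4) q2(4) by simp
  then have kernel: "a * \<beta>\<^sup>2 - b * \<alpha> * \<beta> + c * \<alpha>\<^sup>2 = 0" by (simp add: algebra_simps)
  \<comment> \<open>Up to sign, the bases of these squares are the partial derivatives of the form
    at \<open>(\<beta>, - \<alpha>)\<close>.\<close>
  have "(2 * a * \<beta> - b * \<alpha>)\<^sup>2 = 4 * a * (a * \<beta>\<^sup>2 - b * \<alpha> * \<beta> + c * \<alpha>\<^sup>2) + \<alpha>\<^sup>2 * (b\<^sup>2 - 4 * a * c)"
    "(2 * c * \<alpha> - b * \<beta>)\<^sup>2 = 4 * c * (a * \<beta>\<^sup>2 - b * \<alpha> * \<beta> + c * \<alpha>\<^sup>2) + \<beta>\<^sup>2 * (b\<^sup>2 - 4 * a * c)"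
    by (simp_all add: algebra_simps power2_eq_square)
  moreover have "\<alpha>\<^sup>2 * (b\<^sup>2 - 4 * a * c) \<le> 0" "\<beta>\<^sup>2 * (b\<^sup>2 - 4 * a * c) \<le> 0"
    using q1(3) by (simp_all add: mult_nonneg_nonpos)
  ultimately have "(2 * a * \<beta> - b * \<alpha>)\<^sup>2 \<le> 0" "(2 * c * \<alpha> - b * \<beta>)\<^sup>2 \<le> 0"
    unfolding kernel by simp_all
  then have eqs: "2 * a * \<beta> = b * \<alpha>" "2 * c * \<alpha> = b * \<beta>" by auto
  have affine: "(\<alpha> * x + \<beta> * y + \<gamma>)\<^sup>2 = (\<alpha> * (x - z1) + \<beta> * (y - z2))\<^sup>2" for x y
  proof -
    have "\<alpha> * x + \<beta> * y + \<gamma> = \<alpha> * (x - z1) + \<beta> * (y - z2)" using zero by (simp add: algebra_simps)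
    then show ?thesis by simp
  qed
  show "\<exists>k\<ge>0. \<forall>x y. qf a b c d e p x y = k * ?g x y"
  proof (cases "\<alpha> = 0")
    case True
    then have ab: "a = 0" "b = 0" using eqs ne by auto
    have "qf a b c d e p x y = c / \<beta>\<^sup>2 * ?g x y" for x y
      unfolding affine q1(4) unfolding ab True using ne True by (simp add: power_mult_distrib)
    then show ?thesis using q1(2) by (intro exI[of _ "c / \<beta>\<^sup>2"]) auto
  next
    case False
    have b: "b = 2 * a * \<beta> / \<alpha>" using eqs(1) False by (simp add: field_simps)
    have c: "c = a * \<beta>\<^sup>2 / \<alpha>\<^sup>2" using eqs(2) False by (simp add: b field_simps power2_eq_square)
    have "qf a b c d e p x y = a / \<alpha>\<^sup>2 * ?g x y" for x y
      unfolding affine q1(4) unfolding b c using False by (simp add: field_simps power2_eq_square)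
    then show ?thesis using q1(1) by (intro exI[of _ "a / \<alpha>\<^sup>2"]) auto
  qed
qed

text \<open>A summand vanishes on the axis \<open>x = 0\<close> together with its derivative across
  it, at every height \<open>y\<close> in \<open>[0, 1]\<close>; only the term in
  \<open>x\<^sup>2\<close> survives.\<close>

lemma extremal_square_fst: "extremal (\<lambda>x y. x\<^sup>2)"
proof (rule extremal_qfI[of _ 1 0 0 0 0 0])
  fix a b c d e p
  assume nn: "nonneg_on_F (qf a b c d e p)"
    "nonneg_on_F (qf (1 - a) (0 - b) (0 - c) (0 - d) (0 - e) (0 - p))"
  have c: "c = 0" and p: "p = 0" using nonneg_on_F_coeffs(2,3)[OF nn(1)] nonneg_on_F_coeffs(2,3)[OF nn(2)] by auto
  have e: "e = 0" using nonneg_on_F_coeffs(5)[OF nn(1)] nonneg_on_F_coeffs(5)[OF nn(2)] c by auto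
  have near: "0 \<le> (b * y + d) + a * t" "0 \<le> - (b * y + d) + (1 - a) * t"
    if "0 < t" "t < 1" "0 \<le> y" "y \<le> 1" for t y
  proof -
    have "t * y \<le> 1" using that by (intro mult_le_one) auto
    then have "0 \<le> t * ((b * y + d) + a * t)" "0 \<le> t * (- (b * y + d) + (1 - a) * t)"
      using that nonneg_on_FD[OF nn(1), of t y] nonneg_on_FD[OF nn(2), of t y]
      by (simp_all add: qf_def c e p algebra_simps power2_eq_square)
    then show "0 \<le> (b * y + d) + a * t" "0 \<le> - (b * y + d) + (1 - a) * t"
      using that by (simp_all add: zero_le_mult_iff)
  qed
  have "b * y + d = 0" if y: "0 \<le> y" "y \<le> 1" for y
  proof -
    have "0 \<le> (b * y + d) + a * 0"
      by (rule nonneg_limit[OF _ zero_less_one, of "\<lambda>t. (b * y + d) + a * t"]) (use near y in auto)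
    moreover have "0 \<le> - (b * y + d) + (1 - a) * 0"
      by (rule nonneg_limit[OF _ zero_less_one, of "\<lambda>t. - (b * y + d) + (1 - a) * t"])
        (use near(2) y in \<open>auto simp del: minus_add_distrib\<close>)
    ultimately show ?thesis by simp
  qed
  from this[of 0] this[of 1] show "\<exists>k\<ge>0. a = k * 1 \<and> b = k * 0 \<and> c = k * 0 \<and> d = k * 0 \<and> e = k * 0 \<and> p = k * 0"
    using nonneg_on_F_coeffs(1)[OF nn(1)] c e p by auto
qed (simp add: qf_def)

text \<open>The axes leave only the terms in \<open>x\<close> and \<open>x * y\<close>; the points
  \<open>(t, 1 / t)\<close> with \<open>t\<close> tending to 0 exclude the latter.\<close>

lemma extremal_coord_fst: "extremal (\<lambda>x y. x)"
proof (rule extremal_qfI[of _ 0 0 0 1 0 0])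
  fix a b c d e p
  assume nn: "nonneg_on_F (qf a b c d e p)"
    "nonneg_on_F (qf (0 - a) (0 - b) (0 - c) (1 - d) (0 - e) (0 - p))"
  have acp: "a = 0" "c = 0" "p = 0"
    using nonneg_on_F_coeffs(1-3)[OF nn(1)] nonneg_on_F_coeffs(1-3)[OF nn(2)] by auto
  have e: "e = 0" and d: "0 \<le> d"
    using nonneg_on_F_coeffs(4,5)[OF nn(1)] nonneg_on_F_coeffs(4,5)[OF nn(2)] acp by auto
  have near: "0 \<le> b + d * t" "0 \<le> - b + (1 - d) * t" if "0 < t" for t
    using that nonneg_on_FD[OF nn(1), of t "1 / t"] nonneg_on_FD[OF nn(2), of t "1 / t"]
    by (simp_all add: qf_def acp e algebra_simps)
  have "0 \<le> b + d * 0"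
    by (rule nonneg_limit[OF _ zero_less_one, of "\<lambda>t. b + d * t"]) (use near in auto)
  moreover have "0 \<le> - b + (1 - d) * 0"
    by (rule nonneg_limit[OF _ zero_less_one, of "\<lambda>t. - b + (1 - d) * t"]) (use near in auto)
  ultimately show "\<exists>k\<ge>0. a = k * 0 \<and> b = k * 0 \<and> c = k * 0 \<and> d = k * 1 \<and> e = k * 0 \<and> p = k * 0"
    using acp e d by auto
qed (simp add: qf_def)

lemma extremal_coord_prod: "extremal (\<lambda>x y. x * y)"
proof (rule extremal_qfI[of _ 0 1 0 0 0 0])
  fix a b c d e p
  assume nn: "nonneg_on_F (qf a b c d e p)"
    "nonneg_on_F (qf (0 - a) (1 - b) (0 - c) (0 - d) (0 - e) (0 - p))"
  have acp: "a = 0" "c = 0" "p = 0"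
    using nonneg_on_F_coeffs(1-3)[OF nn(1)] nonneg_on_F_coeffs(1-3)[OF nn(2)] by auto
  have "d = 0" "e = 0"
    using nonneg_on_F_coeffs(4,5)[OF nn(1)] nonneg_on_F_coeffs(4,5)[OF nn(2)] acp by auto
  then show "\<exists>k\<ge>0. a = k * 0 \<and> b = k * 1 \<and> c = k * 0 \<and> d = k * 0 \<and> e = k * 0 \<and> p = k * 0"
    using acp nonneg_on_FD[OF nn(1), of 1 1] by (auto simp: qf_def)
qed (simp add: qf_def)

text \<open>Boundedness on the axes leaves \<open>b\<close> and \<open>p\<close>, and the zero at
  \<open>(1, 1)\<close> gives \<open>b = - p\<close>.\<close>

lemma extremal_hyperbola: "extremal (\<lambda>x y. 1 - x * y)"
proof (rule extremal_qfI[of _ 0 "- 1" 0 0 0 1])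
  fix a b c d e p
  assume nn: "nonneg_on_F (qf a b c d e p)"
    "nonneg_on_F (qf (0 - a) (- 1 - b) (0 - c) (0 - d) (0 - e) (1 - p))"
  have ac: "a = 0" "c = 0" "0 \<le> p"
    using nonneg_on_F_coeffs(1-3)[OF nn(1)] nonneg_on_F_coeffs(1-3)[OF nn(2)] by auto
  have de: "d = 0" "e = 0"
    using nonneg_on_F_coeffs(4,5)[OF nn(1)] nonneg_on_F_coeffs(4,5)[OF nn(2)] ac by auto
  have "b = - p"
    using ac de nonneg_on_FD[OF nn(1), of 1 1] nonneg_on_FD[OF nn(2), of 1 1] by (auto simp: qf_def)
  then show "\<exists>k\<ge>0. a = k * 0 \<and> b = k * - 1 \<and> c = k * 0 \<and> d = k * 0 \<and> e = k * 0 \<and> p = k * 1"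
    using ac de by auto
qed (simp add: qf_def)

lemma DERIV_zero_at_nonneg_zero:
  fixes f :: "real \<Rightarrow> real"
  assumes "DERIV f w :> l" "0 < w" "\<And>x. 0 < x \<Longrightarrow> 0 \<le> f x" "f w = 0"
  shows "l = 0"
proof (rule DERIV_local_min[OF assms(1,2)])
  show "\<forall>y. \<bar>w - y\<bar> < w \<longrightarrow> f w \<le> f y" using assms(3,4) by auto
qed

text \<open>On the hyperbola, \<open>x\<close> times the polynomial is
  \<open>(x - w)\<^sup>2\<close>; a summand inherits the double root at \<open>w\<close>.\<close>

lemma extremal_lifted:
  assumes w: "0 < w" shows "extremal (\<lambda>x y. x + w\<^sup>2 * y - 2 * w * x * y)"
proof (rule extremal_qfI[of _ 0 "- 2 * w" 0 1 "w\<^sup>2" 0])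
  fix a b c d e p
  assume nn: "nonneg_on_F (qf a b c d e p)"
    "nonneg_on_F (qf (0 - a) (- 2 * w - b) (0 - c) (1 - d) (w\<^sup>2 - e) (0 - p))"
  have acp: "a = 0" "c = 0" "p = 0"
    using nonneg_on_F_coeffs(1-3)[OF nn(1)] nonneg_on_F_coeffs(1-3)[OF nn(2)] by auto
  have d: "0 \<le> d" using nonneg_on_F_coeffs(4)[OF nn(1)] acp by auto
  have pos: "0 \<le> d * x\<^sup>2 + b * x + e" if "0 < x" for x
  proof -
    have "0 \<le> x * qf a b c d e p x (1 / x)"
      using that by (intro mult_nonneg_nonneg nonneg_on_FD[OF nn(1)]) auto
    also have "\<dots> = d * x\<^sup>2 + b * x + e"
      using that by (simp add: qf_def acp field_simps power2_eq_square)
    finally show ?thesis .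
  qed
  have "0 \<le> w * qf (0 - a) (- 2 * w - b) (0 - c) (1 - d) (w\<^sup>2 - e) (0 - p) w (1 / w)"
    using w by (intro mult_nonneg_nonneg nonneg_on_FD[OF nn(2)]) auto
  also have "\<dots> = - (d * w\<^sup>2 + b * w + e)"
    using w by (simp add: qf_def acp field_simps power2_eq_square)
  finally have zero: "d * w\<^sup>2 + b * w + e = 0" using pos[OF w] by simp
  have "DERIV (\<lambda>x. d * x\<^sup>2 + b * x + e) w :> d * (2 * w) + b"
    by (auto intro!: derivative_eq_intros)
  then have b: "d * (2 * w) + b = 0"
    by (rule DERIV_zero_at_nonneg_zero[where f = "\<lambda>x. d * x\<^sup>2 + b * x + e", OF _ w pos zero])
  then have "b = - (d * (2 * w))" by simp
  moreover from this have "e = d * w\<^sup>2" using zero by (simp add: power2_eq_square algebra_simps)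
  ultimately show "\<exists>k\<ge>0. a = k * 0 \<and> b = k * (- 2 * w) \<and> c = k * 0 \<and> d = k * 1 \<and> e = k * w\<^sup>2 \<and> p = k * 0"
    using acp d by auto
qed (simp add: qf_def)

text \<open>A summand inherits the double root at \<open>u\<close> on the axis, which fixes
  \<open>d\<close> and \<open>p\<close> in terms of \<open>a\<close>, and the double root at
  \<open>v\<close> of the cubic \<open>f\<close> on the hyperbola, which fixes \<open>b\<close> and
  \<open>e\<close>.\<close>

lemma extremal_bitangent_fst:
  assumes uv: "0 \<le> u" "u < v"
  shows "extremal (\<lambda>x y. (x - u)\<^sup>2 + (v - u) * y * (2 * v\<^sup>2 - (3 * v - u) * x))"
proof (rule extremal_qfI[of _ 1 "- ((v - u) * (3 * v - u))" 0 "- 2 * u" "2 * v\<^sup>2 * (v - u)" "u\<^sup>2"])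
  let ?B = "- ((v - u) * (3 * v - u))" and ?E = "2 * v\<^sup>2 * (v - u)"
  fix a b c d e p
  assume nn: "nonneg_on_F (qf a b c d e p)"
    "nonneg_on_F (qf (1 - a) (?B - b) (0 - c) (- 2 * u - d) (?E - e) (u\<^sup>2 - p))"
  have a: "0 \<le> a" and c: "c = 0"
    using nonneg_on_F_coeffs(1,2)[OF nn(1)] nonneg_on_F_coeffs(1,2)[OF nn(2)] by auto
  have axis: "0 \<le> a * x\<^sup>2 + d * x + p" "0 \<le> (x - u)\<^sup>2 - (a * x\<^sup>2 + d * x + p)" if "0 \<le> x" for x
    using nonneg_on_F_axis[OF nn(1) that] nonneg_on_F_axis[OF nn(2) that]
    by (simp_all add: algebra_simps power2_eq_square)
  have p: "p = - a * u\<^sup>2 - d * u" using axis[OF uv(1)] by simp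
  \<comment> \<open>Testing only to the right of \<open>u\<close> covers \<open>u = 0\<close> as
    well; the two signs of the derivative come from the two summands.\<close>
  have near: "0 \<le> (2 * a * u + d) + a * t" "0 \<le> - (2 * a * u + d) + (1 - a) * t" if t: "0 < t" for t
  proof -
    have "0 \<le> t * ((2 * a * u + d) + a * t)" "0 \<le> t * (- (2 * a * u + d) + (1 - a) * t)"
      using axis[of "u + t"] uv t unfolding p by (simp_all add: algebra_simps power2_eq_square)
    then show "0 \<le> (2 * a * u + d) + a * t" "0 \<le> - (2 * a * u + d) + (1 - a) * t"
      using t by (simp_all add: zero_le_mult_iff)
  qed
  have "0 \<le> (2 * a * u + d) + a * 0"
    by (rule nonneg_limit[OF _ zero_less_one, of "\<lambda>t. (2 * a * u + d) + a * t"]) (use near in auto)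
  moreover have "0 \<le> - (2 * a * u + d) + (1 - a) * 0"
    by (rule nonneg_limit[OF _ zero_less_one, of "\<lambda>t. - (2 * a * u + d) + (1 - a) * t"]) (use near in auto)
  ultimately have d: "d = - 2 * a * u" by simp
  have p: "p = a * u\<^sup>2" unfolding p d by (simp add: power2_eq_square)
  define f where "f x = a * x * (x - u)\<^sup>2 + b * x + e" for x
  have pos: "0 \<le> f x" if "0 < x" for x
  proof -
    have "0 \<le> x * qf a b c d e p x (1 / x)"
      using that by (intro mult_nonneg_nonneg nonneg_on_FD[OF nn(1)]) auto
    also have "\<dots> = f x"
      using that by (simp add: f_def qf_def c d p field_simps power2_eq_square)
    finally show ?thesis .
  qed
  have v: "0 < v" using uv by simp
  have "0 \<le> v * qf (1 - a) (?B - b) (0 - c) (- 2 * u - d) (?E - e) (u\<^sup>2 - p) v (1 / v)"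
    using v by (intro mult_nonneg_nonneg nonneg_on_FD[OF nn(2)]) auto
  also have "\<dots> = - f v"
    using v by (simp add: f_def qf_def c d p field_simps power2_eq_square)
  finally have zero: "f v = 0" using pos[OF v] by simp
  have "DERIV f v :> a * (v - u)\<^sup>2 + a * v * (2 * (v - u)) + b"
    unfolding f_def by (auto intro!: derivative_eq_intros)
  from DERIV_zero_at_nonneg_zero[OF this v pos zero]
  have b: "b = a * ?B" by (simp add: algebra_simps power2_eq_square)
  have e: "e = a * ?E" using zero unfolding f_def b by (simp add: algebra_simps power2_eq_square)
  show "\<exists>k\<ge>0. a = k * 1 \<and> b = k * ?B \<and> c = k * 0 \<and> d = k * (- 2 * u) \<and> e = k * ?E \<and> p = k * u\<^sup>2"
    by (rule exI[of _ a]) (use a b c d e p in simp)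
qed (simp add: qf_def algebra_simps power2_eq_square)

lemma generator_extremal:
  assumes "generator g" shows "extremal g"
  using assms
proof cases
  case square_snd
  then show ?thesis using extremal_swap[OF extremal_square_fst] by simp
next
  case coord_snd
  then show ?thesis using extremal_swap[OF extremal_coord_fst] by simp
next
  case (bitangent_snd u v)
  then show ?thesis using extremal_swap[OF extremal_bitangent_fst[of u v]] by simp
qed (simp_all add: extremal_affine_square extremal_square_fst extremal_coord_fst extremal_coord_prod
    extremal_hyperbola extremal_lifted extremal_bitangent_fst)

section \<open>Quadratics as coefficient triples\<close>

definition quad_of :: "real \<Rightarrow> real \<Rightarrow> real \<Rightarrow> real \<Rightarrow> real \<Rightarrow> real \<Rightarrow> quad" where
  "quad_of a b c d e p = (vector [vector [a, b / 2], vector [b / 2, c]], vector [d / 2, e / 2], p)"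

lemma qval_quad_of: "qval (quad_of a b c d e p) x = qf a b c d e p (x$1) (x$2)"
  by (simp add: qval_def quad_of_def qf_def inner_vec_def sum_2 matrix_vector_mult_def
      algebra_simps power2_eq_square)

lemma quad_of_in_quads: "quad_of a b c d e p \<in> quads"
  by (simp add: quads_def quad_of_def transpose_def vec_eq_iff forall_2)

lemma quads_cases:
  assumes "q \<in> quads"
  obtains a b c d e p where "q = quad_of a b c d e p"
proof -
  obtain R r p where q: "q = (R, r, p)" by (cases q)
  have "R$1$2 = R$2$1" using assms by (auto simp: q quads_def transpose_def vec_eq_iff)
  then have "q = quad_of (R$1$1) (2 * R$1$2) (R$2$2) (2 * r$1) (2 * r$2) p"
    by (simp add: q quad_of_def vec_eq_iff forall_2)
  then show thesis by (rule that)
qed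

lemma qf_coeffs_eq:
  assumes "\<And>x y. qf a b c d e p x y = qf a' b' c' d' e' p' x y"
  shows "a = a' \<and> b = b' \<and> c = c' \<and> d = d' \<and> e = e' \<and> p = p'"
proof -
  have p: "p = p'" using assms[of 0 0] by (simp add: qf_def)
  have "a + d = a' + d'" "a - d = a' - d'" using assms[of 1 0] assms[of "-1" 0] p by (simp_all add: qf_def)
  then have ad: "a = a'" "d = d'" by linarith+
  have "c + e = c' + e'" "c - e = c' - e'" using assms[of 0 1] assms[of 0 "-1"] p by (simp_all add: qf_def)
  then have ce: "c = c'" "e = e'" by linarith+
  have "b = b'" using assms[of 1 1] p ad ce by (simp add: qf_def)
  then show ?thesis using p ad ce by simp
qed

lemma qval_eqD:
  assumes "q \<in> quads" "q' \<in> quads" "\<And>x. qval q x = qval q' x"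
  shows "q = q'"
proof -
  obtain a b c d e p where q: "q = quad_of a b c d e p" using assms(1) by (rule quads_cases)
  obtain a' b' c' d' e' p' where q': "q' = quad_of a' b' c' d' e' p'" using assms(2) by (rule quads_cases)
  have "qf a b c d e p x y = qf a' b' c' d' e' p' x y" for x y
    using assms(3)[of "vector [x, y]"] by (simp add: q q' qval_quad_of)
  then show ?thesis using qf_coeffs_eq q q' by metis
qed

lemma qval_add: "qval (q + q') x = qval q x + qval q' x"
  by (cases q; cases q') (simp add: qval_def matrix_vector_mult_add_rdistrib inner_add_left inner_add_right algebra_simps)

lemma qval_scaleR: "qval (k *\<^sub>R q) x = k * qval q x"
  by (cases q) (simp add: qval_def scaleR_matrix_vector_assoc[symmetric] algebra_simps)

lemma quads_add: "q \<in> quads \<Longrightarrow> q' \<in> quads \<Longrightarrow> q + q' \<in> quads"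
  by (cases q; cases q') (simp add: quads_def transpose_def vec_eq_iff)

lemma quads_scaleR: "q \<in> quads \<Longrightarrow> k *\<^sub>R q \<in> quads"
  by (cases q) (simp add: quads_def transpose_def vec_eq_iff)

lemma quad_of_mem_iff: "quad_of a b c d e p \<in> nonneg_quads Freg \<longleftrightarrow> nonneg_on_F (qf a b c d e p)"
proof
  assume *: "quad_of a b c d e p \<in> nonneg_quads Freg"
  show "nonneg_on_F (qf a b c d e p)"
    unfolding nonneg_on_F_def
  proof (intro allI impI)
    fix x y :: real assume "0 \<le> x" "0 \<le> y" "x * y \<le> 1"
    then have "vector [x, y] \<in> Freg" by (simp add: Freg_def)
    then have "0 \<le> qval (quad_of a b c d e p) (vector [x, y])" using * by (auto simp: nonneg_quads_def)
    then show "0 \<le> qf a b c d e p x y" by (simp add: qval_quad_of)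
  qed
qed (auto simp: nonneg_quads_def quad_of_in_quads qval_quad_of Freg_def nonneg_on_F_def)

lemma interior_Freg: "interior Freg = {z. 0 < z$1 \<and> 0 < z$2 \<and> z$1 * z$2 < 1}" (is "_ = ?U")
proof
  have "open ?U" by (intro open_Collect_conj open_Collect_less continuous_intros)
  then show "?U \<subseteq> interior Freg" by (rule interior_maximal[rotated]) (auto simp: Freg_def)
next
  show "interior Freg \<subseteq> ?U"
  proof
    fix z assume "z \<in> interior Freg"
    then obtain \<delta> where \<delta>: "0 < \<delta>" "ball z \<delta> \<subseteq> Freg" by (auto simp: mem_interior)
    have "z + s *\<^sub>R axis i 1 \<in> Freg" if "\<bar>s\<bar> < \<delta>" for s i
      using \<delta>(2) that by (auto simp: subset_iff dist_norm)
    \<comment> \<open>Steps to the left and down give positive coordinates; with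
      \<open>z$2 > 0\<close>, the step to the right makes \<open>z$1 * z$2 < 1\<close>
      strict.\<close>
    from this[of "- \<delta> / 2" 1] this[of "- \<delta> / 2" 2] this[of "\<delta> / 2" 1]
    have *: "0 \<le> z$1 - \<delta> / 2" "0 \<le> z$2 - \<delta> / 2" "(z$1 + \<delta> / 2) * z$2 \<le> 1"
      using \<delta>(1) by (auto simp: Freg_def axis_def)
    moreover have "0 < \<delta> / 2 * z$2" using * \<delta>(1) by (intro mult_pos_pos) auto
    moreover have "(z$1 + \<delta> / 2) * z$2 = z$1 * z$2 + \<delta> / 2 * z$2" by (simp add: algebra_simps)
    ultimately have "z$1 * z$2 < 1" by linarith
    then show "z \<in> ?U" using * \<delta>(1) by auto
  qed
qed

lemma listed_polys_eq: "listed_polys = {\<lambda>x. g (x$1) (x$2) | g. generator g}"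
proof (intro equalityI subsetI)
  fix f :: "real^2 \<Rightarrow> real" assume "f \<in> listed_polys"
  then consider (sq) "f \<in> interior_affine_squares" | (rest) "f \<notin> interior_affine_squares" by blast
  then show "f \<in> {\<lambda>x. g (x$1) (x$2) | g. generator g}"
  proof cases
    case sq
    then obtain a b z where f: "f = (\<lambda>x. (a \<bullet> x + b)\<^sup>2)" and az: "a \<noteq> 0" "z \<in> interior Freg" "a \<bullet> z + b = 0"
      unfolding interior_affine_squares_def by blast
    have "generator (\<lambda>x y. (a$1 * x + a$2 * y + b)\<^sup>2)"
      using az by (intro generator.affine_square[of "z$1" "z$2"])
        (auto simp: interior_Freg inner_vec_def sum_2 vec_eq_iff forall_2)
    then show ?thesis unfolding f by (intro CollectI exI conjI) (auto simp: inner_vec_def sum_2)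
  next
    case rest
    have bits: "bitangent1 u v = (\<lambda>x. (\<lambda>x y. (x - u)\<^sup>2 + (v - u) * y * (2 * v\<^sup>2 - (3 * v - u) * x)) (x$1) (x$2))"
      "bitangent2 u v = (\<lambda>x. (\<lambda>x y. (y - u)\<^sup>2 + (v - u) * x * (2 * v\<^sup>2 - (3 * v - u) * y)) (x$1) (x$2))"
      "lifted_tangent w = (\<lambda>x. (\<lambda>x y. x + w\<^sup>2 * y - 2 * w * x * y) (x$1) (x$2))" for u v w
      by (simp_all add: fun_eq_iff bitangent1_def bitangent2_def lifted_tangent_def)
    show ?thesis
      using \<open>f \<in> listed_polys\<close> rest unfolding listed_polys_def bits
      by (auto intro: generator.intros)
  qed
next
  fix f :: "real^2 \<Rightarrow> real" assume "f \<in> {\<lambda>x. g (x$1) (x$2) | g. generator g}"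
  then obtain g where f: "f = (\<lambda>x. g (x$1) (x$2))" and "generator g" by blast
  from this(2) show "f \<in> listed_polys"
  proof cases
    case (affine_square z1 z2 \<alpha> \<beta> \<gamma>)
    have "f = (\<lambda>x. (vector [\<alpha>, \<beta>] \<bullet> x + \<gamma>)\<^sup>2)" "vector [\<alpha>, \<beta>] \<noteq> (0 :: real^2)"
      "vector [z1, z2] \<in> interior Freg" "vector [\<alpha>, \<beta>] \<bullet> (vector [z1, z2] :: real^2) + \<gamma> = 0"
      using affine_square by (auto simp: f interior_Freg inner_vec_def sum_2 vec_eq_iff forall_2)
    then have "f \<in> interior_affine_squares" unfolding interior_affine_squares_def by blast
    then show ?thesis by (simp add: listed_polys_def)
  next
    case (lifted w)
    then have "f = lifted_tangent w" by (simp add: f fun_eq_iff lifted_tangent_def)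
    then show ?thesis using lifted by (auto simp: listed_polys_def)
  next
    case (bitangent_fst u v)
    then have "f = bitangent1 u v" by (simp add: f fun_eq_iff bitangent1_def)
    then show ?thesis using bitangent_fst by (auto simp: listed_polys_def)
  next
    case (bitangent_snd u v)
    then have "f = bitangent2 u v" by (simp add: f fun_eq_iff bitangent2_def)
    then show ?thesis using bitangent_snd by (auto simp: listed_polys_def)
  qed (simp_all add: f listed_polys_def)
qed

lemma generator_is_qf:
  assumes "generator g"
  obtains a b c d e p where "g = qf a b c d e p"
  using assms
proof cases
  case (affine_square z1 z2 \<alpha> \<beta> \<gamma>)
  show thesis
    by (rule that[of "\<alpha>\<^sup>2" "2 * \<alpha> * \<beta>" "\<beta>\<^sup>2" "2 * \<alpha> * \<gamma>" "2 * \<beta> * \<gamma>" "\<gamma>\<^sup>2"])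
      (simp add: affine_square fun_eq_iff qf_def algebra_simps power2_eq_square)
next
  case square_fst
  show thesis by (rule that[of 1 0 0 0 0 0]) (simp add: square_fst fun_eq_iff qf_def)
next
  case square_snd
  show thesis by (rule that[of 0 0 1 0 0 0]) (simp add: square_snd fun_eq_iff qf_def)
next
  case coord_fst
  show thesis by (rule that[of 0 0 0 1 0 0]) (simp add: coord_fst fun_eq_iff qf_def)
next
  case coord_snd
  show thesis by (rule that[of 0 0 0 0 1 0]) (simp add: coord_snd fun_eq_iff qf_def)
next
  case coord_prod
  show thesis by (rule that[of 0 1 0 0 0 0]) (simp add: coord_prod fun_eq_iff qf_def)
next
  case hyperbola
  show thesis by (rule that[of 0 "- 1" 0 0 0 1]) (simp add: hyperbola fun_eq_iff qf_def)
next
  case (lifted w)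
  show thesis by (rule that[of 0 "- 2 * w" 0 1 "w\<^sup>2" 0]) (simp add: lifted fun_eq_iff qf_def)
next
  case (bitangent_fst u v)
  show thesis
    by (rule that[of 1 "- ((v - u) * (3 * v - u))" 0 "- 2 * u" "2 * v\<^sup>2 * (v - u)" "u\<^sup>2"])
      (simp add: bitangent_fst fun_eq_iff qf_def algebra_simps power2_eq_square)
next
  case (bitangent_snd u v)
  show thesis
    by (rule that[of 0 "- ((v - u) * (3 * v - u))" 1 "2 * v\<^sup>2 * (v - u)" "- 2 * u" "u\<^sup>2"])
      (simp add: bitangent_snd fun_eq_iff qf_def algebra_simps power2_eq_square)
qed

lemma generator_nonzero:
  assumes "generator g" shows "\<exists>x y. g x y \<noteq> 0"
  using assms
proof cases
  case (affine_square z1 z2 \<alpha> \<beta> \<gamma>)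
  have "g (z1 + \<alpha>) (z2 + \<beta>) = (\<alpha> * \<alpha> + \<beta> * \<beta>)\<^sup>2"
  proof -
    have "\<alpha> * (z1 + \<alpha>) + \<beta> * (z2 + \<beta>) + \<gamma> = \<alpha> * \<alpha> + \<beta> * \<beta>"
      using affine_square by (simp add: algebra_simps)
    then show ?thesis unfolding affine_square(1) by simp
  qed
  moreover have "\<alpha> * \<alpha> + \<beta> * \<beta> \<noteq> 0"
    using affine_square by (simp add: sum_squares_eq_zero_iff)
  ultimately have "g (z1 + \<alpha>) (z2 + \<beta>) \<noteq> 0" by simp
  then show ?thesis by blast
next
  case (lifted w)
  then have "g 1 0 \<noteq> 0" by simp
  then show ?thesis by blast
next
  case (bitangent_fst u v)
  then have "g (u + 1) 0 \<noteq> 0" by simp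
  then show ?thesis by blast
next
  case (bitangent_snd u v)
  then have "g 0 (u + 1) \<noteq> 0" by simp
  then show ?thesis by blast
qed (auto intro: exI[of _ 1] exI[of _ 0])

lemma listed_quad:
  assumes "q \<in> quads" "qval q \<in> listed_polys"
  obtains a b c d e p where "q = quad_of a b c d e p" "generator (qf a b c d e p)"
proof -
  obtain a b c d e p where q: "q = quad_of a b c d e p" using assms(1) by (rule quads_cases)
  obtain g where g: "qval q = (\<lambda>x. g (x$1) (x$2))" "generator g"
    using assms(2) unfolding listed_polys_eq by blast
  have "g x y = qf a b c d e p x y" for x y
    using fun_cong[OF g(1), of "vector [x, y]"] by (simp add: q qval_quad_of)
  then have "g = qf a b c d e p" by (intro ext)
  then show thesis using that q g(2) by blast
qed

section \<open>Conical combinations and rays\<close>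

lemma conical_combinations_superset: "S \<subseteq> conical_combinations S"
proof
  fix s assume "s \<in> S"
  then show "s \<in> conical_combinations S"
    unfolding conical_combinations_def by (intro CollectI exI[of _ "{s}"] exI[of _ "\<lambda>_. 1"]) auto
qed

lemma conical_combinations_scaleR:
  assumes "x \<in> conical_combinations S" "0 \<le> k" shows "k *\<^sub>R x \<in> conical_combinations S"
proof -
  obtain T c where "x = (\<Sum>s\<in>T. c s *\<^sub>R s)" "finite T" "T \<subseteq> S" "\<forall>s\<in>T. 0 \<le> c s"
    using assms(1) unfolding conical_combinations_def by blast
  then show ?thesis unfolding conical_combinations_def using assms(2)
    by (intro CollectI exI[of _ T] exI[of _ "\<lambda>s. k * c s"]) (auto simp: scaleR_sum_right)
qed

lemma conical_combinations_add:
  assumes "x \<in> conical_combinations S" "y \<in> conical_combinations S"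
  shows "x + y \<in> conical_combinations S"
proof -
  obtain T c where T: "x = (\<Sum>s\<in>T. c s *\<^sub>R s)" "finite T" "T \<subseteq> S" "\<forall>s\<in>T. 0 \<le> c s"
    using assms(1) unfolding conical_combinations_def by blast
  obtain T' c' where T': "y = (\<Sum>s\<in>T'. c' s *\<^sub>R s)" "finite T'" "T' \<subseteq> S" "\<forall>s\<in>T'. 0 \<le> c' s"
    using assms(2) unfolding conical_combinations_def by blast
  \<comment> \<open>The index sets may overlap, so coefficients are extended by 0 and added.\<close>
  define C where "C s = (if s \<in> T then c s else 0) + (if s \<in> T' then c' s else 0)" for s
  have "x = (\<Sum>s\<in>T \<union> T'. (if s \<in> T then c s else 0) *\<^sub>R s)"
    unfolding T(1) using T(2) T'(2) by (intro sum.mono_neutral_cong_left) auto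
  moreover have "y = (\<Sum>s\<in>T \<union> T'. (if s \<in> T' then c' s else 0) *\<^sub>R s)"
    unfolding T'(1) using T(2) T'(2) by (intro sum.mono_neutral_cong_left) auto
  ultimately have "x + y = (\<Sum>s\<in>T \<union> T'. C s *\<^sub>R s)"
    by (simp add: C_def scaleR_add_left sum.distrib)
  then show ?thesis unfolding conical_combinations_def using T T'
    by (intro CollectI exI[of _ "T \<union> T'"] exI[of _ C]) (auto simp: C_def)
qed

lemma sum_in_cone:
  assumes "0 \<in> K" "\<And>x y. x \<in> K \<Longrightarrow> y \<in> K \<Longrightarrow> x + y \<in> K" "\<And>x. x \<in> A \<Longrightarrow> f x \<in> K"
  shows "sum f A \<in> K"
  using assms(3)
proof (induction A rule: infinite_finite_induct)
  case (insert x A)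
  then have "f x + sum f A \<in> K" by (intro assms(2)) auto
  then show ?case using insert by simp
qed (simp_all add: assms(1))

lemma ray_scaleR: "0 < k \<Longrightarrow> ray (k *\<^sub>R q) = ray q"
  unfolding ray_def by (auto intro: exI[of _ "_ * k"])
    (metis divide_nonneg_pos nonzero_eq_divide_eq less_irrefl)

lemma nonneg_quads_add: "q \<in> nonneg_quads S \<Longrightarrow> q' \<in> nonneg_quads S \<Longrightarrow> q + q' \<in> nonneg_quads S"
  by (auto simp: nonneg_quads_def quads_add qval_add)

lemma nonneg_quads_scaleR: "q \<in> nonneg_quads S \<Longrightarrow> 0 \<le> k \<Longrightarrow> k *\<^sub>R q \<in> nonneg_quads S"
  by (auto simp: nonneg_quads_def quads_scaleR qval_scaleR)

lemma nonneg_quads_zero: "0 \<in> nonneg_quads S"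
  by (auto simp: nonneg_quads_def quads_def qval_def zero_prod_def transpose_def vec_eq_iff)

section \<open>Extreme rays of the cone of coefficient triples\<close>

lemma listed_in_cone:
  assumes "q \<in> quads" "qval q \<in> listed_polys" shows "q \<in> nonneg_quads Freg"
  using listed_quad[OF assms] generator_nonneg quad_of_mem_iff by metis

lemma listed_spans_extreme_ray:
  assumes q: "q \<in> quads" "qval q \<in> listed_polys"
  shows "spans_extreme_ray (nonneg_quads Freg) q"
  unfolding spans_extreme_ray_def
proof (intro conjI ballI impI)
  obtain a b c d e p where q_eq: "q = quad_of a b c d e p" and gen: "generator (qf a b c d e p)"
    using listed_quad[OF q] .
  show "q \<in> nonneg_quads Freg" using listed_in_cone[OF q] .
  obtain x y where "qf a b c d e p x y \<noteq> 0" using generator_nonzero[OF gen] by blast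
  then have "qval q (vector [x, y]) \<noteq> 0" by (simp add: q_eq qval_quad_of)
  moreover have "qval 0 z = 0" for z by (simp add: qval_def zero_prod_def)
  ultimately show "q \<noteq> 0" by metis
  have part: "q1 \<in> ray q"
    if "q1 \<in> nonneg_quads Freg" "q2 \<in> nonneg_quads Freg" "q = q1 + q2" for q1 q2
  proof -
    have quads: "q1 \<in> quads" "q2 \<in> quads" using that by (auto simp: nonneg_quads_def)
    obtain a1 b1 c1 d1 e1 p1 where q1: "q1 = quad_of a1 b1 c1 d1 e1 p1"
      using quads(1) by (rule quads_cases)
    obtain a2 b2 c2 d2 e2 p2 where q2: "q2 = quad_of a2 b2 c2 d2 e2 p2"
      using quads(2) by (rule quads_cases)
    have "qval q (vector [x, y]) = qval q1 (vector [x, y]) + qval q2 (vector [x, y])" for x y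
      unfolding that(3) by (rule qval_add)
    then have "qf a b c d e p x y = qf a1 b1 c1 d1 e1 p1 x y + qf a2 b2 c2 d2 e2 p2 x y" for x y
      by (simp add: q_eq q1 q2 qval_quad_of)
    then have "(\<lambda>x y. qf a b c d e p x y - qf a1 b1 c1 d1 e1 p1 x y) = qf a2 b2 c2 d2 e2 p2"
      by (intro ext) simp
    then have "nonneg_on_F (\<lambda>x y. qf a b c d e p x y - qf a1 b1 c1 d1 e1 p1 x y)"
      "nonneg_on_F (qf a1 b1 c1 d1 e1 p1)"
      using that(1,2) by (simp_all add: q1 q2 quad_of_mem_iff)
    then obtain k where k: "0 \<le> k" "\<And>x y. qf a1 b1 c1 d1 e1 p1 x y = k * qf a b c d e p x y"
      using generator_extremal[OF gen] unfolding extremal_def by blast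
    have "q1 = k *\<^sub>R q"
      by (rule qval_eqD[OF quads(1) quads_scaleR[OF q(1)]]) (simp add: q1 q_eq qval_quad_of qval_scaleR k(2))
    then show ?thesis using k(1) by (auto simp: ray_def)
  qed
  fix q1 q2 assume "q1 \<in> nonneg_quads Freg" "q2 \<in> nonneg_quads Freg" "q = q1 + q2"
  then show "q1 \<in> ray q" "q2 \<in> ray q" using part[of q1 q2] part[of q2 q1] by (auto simp: add.commute)
qed

text \<open>Rule induction, for an arbitrary set \<open>C\<close> closed under sums and nonnegative
  multiples; it is applied to conical combinations.\<close>

lemma decomp_in_cone:
  assumes "decomp f" and gens: "{q \<in> quads. qval q \<in> listed_polys} \<subseteq> C"
    and cone: "\<And>q q'. q \<in> C \<Longrightarrow> q' \<in> C \<Longrightarrow> q + q' \<in> C" "\<And>k q. q \<in> C \<Longrightarrow> 0 \<le> k \<Longrightarrow> k *\<^sub>R q \<in> C"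
  shows "\<exists>q\<in>quads. (\<forall>x. qval q x = f (x$1) (x$2)) \<and> q \<in> C"
  using assms(1)
proof induction
  case (gen f)
  then obtain a b c d e p where f: "f = qf a b c d e p" using generator_is_qf by metis
  have "qval (quad_of a b c d e p) = (\<lambda>x. f (x$1) (x$2))" by (simp add: fun_eq_iff f qval_quad_of)
  then have "qval (quad_of a b c d e p) \<in> listed_polys" using gen unfolding listed_polys_eq by auto
  then have "quad_of a b c d e p \<in> C" using gens quad_of_in_quads by blast
  then show ?case by (intro bexI[OF _ quad_of_in_quads]) (auto simp: f qval_quad_of)
next
  case (add f g)
  then obtain q q' where "q \<in> quads" "\<forall>x. qval q x = f (x$1) (x$2)" "q \<in> C"
    and "q' \<in> quads" "\<forall>x. qval q' x = g (x$1) (x$2)" "q' \<in> C" by blast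
  then show ?case by (intro bexI[of _ "q + q'"]) (simp_all add: qval_add quads_add cone)
next
  case (scale k f)
  then obtain q where "q \<in> quads" "\<forall>x. qval q x = f (x$1) (x$2)" "q \<in> C" by blast
  then show ?case
    using scale(1) by (intro bexI[of _ "k *\<^sub>R q"]) (simp_all add: qval_scaleR quads_scaleR cone)
qed

text \<open>The decomposition is over whole rays rather than chosen representatives, to match the
  union of extreme rays.\<close>

lemma nonneg_quads_conical:
  assumes "q \<in> nonneg_quads Freg"
  shows "q \<in> conical_combinations (\<Union>(ray ` {q \<in> quads. qval q \<in> listed_polys}))" (is "_ \<in> ?C")
proof -
  have q: "q \<in> quads" using assms by (simp add: nonneg_quads_def)
  then obtain a b c d e p where q_eq: "q = quad_of a b c d e p" by (rule quads_cases)
  then have dec: "decomp (qf a b c d e p)" using assms decomp_nonneg quad_of_mem_iff by metis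
  have "g \<in> ray g" for g :: quad
    unfolding ray_def by (intro CollectI exI[of _ 1]) auto
  then have sub: "{q \<in> quads. qval q \<in> listed_polys} \<subseteq> \<Union>(ray ` {q \<in> quads. qval q \<in> listed_polys})" by blast
  define C where "C = ?C"
  have "{q \<in> quads. qval q \<in> listed_polys} \<subseteq> C"
    unfolding C_def by (rule subset_trans[OF sub conical_combinations_superset])
  then have "\<exists>q\<in>quads. (\<forall>x. qval q x = qf a b c d e p (x$1) (x$2)) \<and> q \<in> C"
    by (rule decomp_in_cone[OF dec])
      (simp_all add: C_def conical_combinations_add conical_combinations_scaleR)
  then obtain q' where q': "q' \<in> quads" "\<forall>x. qval q' x = qf a b c d e p (x$1) (x$2)" "q' \<in> C"
    by blast
  have "q = q'" by (rule qval_eqD[OF q q'(1)]) (simp add: q_eq qval_quad_of q'(2))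
  then show ?thesis using q'(3) by (simp add: C_def)
qed

text \<open>Some term of a conical decomposition of an extreme \<open>q\<close> is nonzero, and extremality
  makes it a multiple of \<open>q\<close>.\<close>

lemma extreme_ray_listed:
  assumes ext: "spans_extreme_ray (nonneg_quads Freg) q"
  shows "\<exists>g\<in>quads. qval g \<in> listed_polys \<and> ray q = ray g"
proof -
  let ?K = "nonneg_quads Freg"
  have q: "q \<in> ?K" "q \<noteq> 0" and split: "\<And>q1 q2. q1 \<in> ?K \<Longrightarrow> q2 \<in> ?K \<Longrightarrow> q = q1 + q2 \<Longrightarrow> q1 \<in> ray q"
    using ext unfolding spans_extreme_ray_def by blast+
  obtain T c where T: "q = (\<Sum>s\<in>T. c s *\<^sub>R s)" "finite T"
    "T \<subseteq> \<Union>(ray ` {q \<in> quads. qval q \<in> listed_polys})" "\<forall>s\<in>T. 0 \<le> c s"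
    using nonneg_quads_conical[OF q(1)] unfolding conical_combinations_def by blast
  have "\<exists>s\<in>T. c s *\<^sub>R s \<noteq> 0"
  proof (rule ccontr)
    assume "\<not> ?thesis"
    then have "q = 0" unfolding T(1) by (intro sum.neutral) auto
    then show False using q(2) by contradiction
  qed
  then obtain s where s: "s \<in> T" "c s *\<^sub>R s \<noteq> 0" by blast
  have in_K: "c t *\<^sub>R t \<in> ?K" if "t \<in> T" for t
  proof -
    obtain g l where "g \<in> quads" "qval g \<in> listed_polys" "t = l *\<^sub>R g" "0 \<le> l"
      using T(3) \<open>t \<in> T\<close> unfolding ray_def by blast
    then show ?thesis using T(4) that listed_in_cone by (simp add: nonneg_quads_scaleR)
  qed
  have "c s *\<^sub>R s \<in> ray q"
  proof (rule split)
    show "q = c s *\<^sub>R s + (\<Sum>t\<in>T - {s}. c t *\<^sub>R t)"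
      unfolding T(1) by (rule sum.remove[OF T(2) s(1)])
    show "(\<Sum>t\<in>T - {s}. c t *\<^sub>R t) \<in> ?K"
      by (rule sum_in_cone) (auto intro: nonneg_quads_zero nonneg_quads_add in_K)
  qed (rule in_K[OF s(1)])
  then obtain k where k: "0 \<le> k" "c s *\<^sub>R s = k *\<^sub>R q" unfolding ray_def by blast
  obtain g l where g: "g \<in> quads" "qval g \<in> listed_polys" "s = l *\<^sub>R g" "0 \<le> l"
    using T(3) s(1) unfolding ray_def by blast
  have pos: "0 < k" "0 < c s * l"
    using k s g T(4) by (auto simp: less_le)
  have "ray q = ray (k *\<^sub>R q)" by (rule ray_scaleR[OF pos(1), symmetric])
  also have "k *\<^sub>R q = (c s * l) *\<^sub>R g" using k(2) g(3) by simp
  also have "ray \<dots> = ray g" by (rule ray_scaleR[OF pos(2)])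
  finally show ?thesis using g by blast
qed

theorem theorem1p1:
  "listed_polys \<subseteq> qval ` quads \<and>
   extreme_rays (nonneg_quads Freg) = ray ` {q \<in> quads. qval q \<in> listed_polys} \<and>
   nonneg_quads Freg = conical_combinations (\<Union> (extreme_rays (nonneg_quads Freg)))"
proof (intro conjI)
  \<comment> \<open>Ensures that the set comprehension over \<open>quads\<close> in the next claim
    misses no listed polynomial.\<close>
  show "listed_polys \<subseteq> qval ` quads"
  proof
    fix f assume "f \<in> listed_polys"
    then obtain g where f: "f = (\<lambda>x. g (x$1) (x$2))" and g: "generator g" unfolding listed_polys_eq by blast
    obtain a b c d e p where "g = qf a b c d e p" using g by (rule generator_is_qf)
    then have "f = qval (quad_of a b c d e p)" by (simp add: f fun_eq_iff qval_quad_of)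
    then show "f \<in> qval ` quads" using quad_of_in_quads by blast
  qed
  show rays: "extreme_rays (nonneg_quads Freg) = ray ` {q \<in> quads. qval q \<in> listed_polys}"
    unfolding extreme_rays_def using listed_spans_extreme_ray extreme_ray_listed by blast
  show "nonneg_quads Freg = conical_combinations (\<Union> (extreme_rays (nonneg_quads Freg)))"
  proof (intro equalityI subsetI)
    fix q assume "q \<in> nonneg_quads Freg"
    then show "q \<in> conical_combinations (\<Union> (extreme_rays (nonneg_quads Freg)))"
      unfolding rays by (rule nonneg_quads_conical)
  next
    fix q assume "q \<in> conical_combinations (\<Union> (extreme_rays (nonneg_quads Freg)))"
    then obtain T c where T: "q = (\<Sum>s\<in>T. c s *\<^sub>R s)"
      "T \<subseteq> \<Union> (extreme_rays (nonneg_quads Freg))" "\<forall>s\<in>T. 0 \<le> c s"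
      unfolding conical_combinations_def by blast
    have "s \<in> nonneg_quads Freg" if s: "s \<in> T" for s
    proof -
      obtain g where g: "spans_extreme_ray (nonneg_quads Freg) g" "s \<in> ray g"
        using T(2) s unfolding extreme_rays_def by blast
      then obtain k where "s = k *\<^sub>R g" "0 \<le> k" unfolding ray_def by blast
      moreover have "g \<in> nonneg_quads Freg" using g(1) by (simp add: spans_extreme_ray_def)
      ultimately show ?thesis by (simp add: nonneg_quads_scaleR)
    qed
    then show "q \<in> nonneg_quads Freg" unfolding T(1) using T(3)
      by (intro sum_in_cone nonneg_quads_zero nonneg_quads_add nonneg_quads_scaleR) auto
  qed
qed

end
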